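(* Let $(E_7)^{-\sigma}=\{\alpha\in E_7\mid(-\sigma)\alpha(-\sigma)^{-1}=\alpha\}$ and $(E_7)^{\iota}=\{\alpha\in E_7\mid\iota\alpha\iota^{-1}=\alpha\}$. Then $$(E_7)^{-\sigma}\cap (E_7)^{\iota}\;\cong\;(U(1)\times U(1)\times Spin(10))/(\mathbf{Z}_4\times\mathbf{Z}_3),$$ where $\mathbf{Z}_4=\{(1,1,1),(1,-1,\sigma),(1,i,\sigma\phi_1(i)),(1,-i,\phi_1(i))\}$ and $\mathbf{Z}_3=\{(1,1,1),(\omega,\omega,1),(\omega^2,\omega^2,1)\}$ with $\omega\in C$, $\omega^3=1$, $\omega\ne1$.
   Context: Let $\mathfrak{C}$ be the division Cayley algebra (octonions), $\mathfrak{J}=\{X\in M(3,\mathfrak{C})\mid X^*=X\}$, with elements $X=\begin{pmatrix}\xi_1&x_3&\overline{x}_2\\ \overline{x}_3&\xi_2&x_1\\ x_2&\overline{x}_1&\xi_3\end{pmatrix}$, $\mathfrak{J}^C=\mathfrak{J}\oplus i\mathfrak{J}$ its complexification ($C=\mathbf{R}\oplus\mathbf{R}i$), $\tau$ the complex conjugation, $X\circ Y=\frac12(XY+YX)$, $(X,Y)=\mathrm{tr}(X\circ Y)$, $X\times Y=\frac12\big(2X\circ Y-\mathrm{tr}(X)Y-\mathrm{tr}(Y)X+(\mathrm{tr}(X)\mathrm{tr}(Y)-(X,Y))E\big)$, $\det X=\frac13(X,X\times X)$, $\langle X,Y\rangle=(\tau X,Y)$. $E_6=\{\alpha\in\mathrm{Iso}_C(\mathfrak{J}^C)\mid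 \det\alpha X=\det X,\ \langle\alpha X,\alpha Y\rangle=\langle X,Y\rangle\}$. Let ${\mathfrak{e}_6}^C=\{\phi\in\mathrm{Hom}_C(\mathfrak{J}^C,\mathfrak{J}^C)\mid(\phi X,X\times X)=0\}$, and ${}^t\phi$ the transpose with respect to $(X,Y)$. For $X,W\in\mathfrak{J}^C$ define $X\vee W\in{\mathfrak{e}_6}^C$ by $(X\vee W)U=\frac12(W,U)X+\frac16(X,W)U-2W\times(X\times U)$. Let $\mathfrak{P}^C=\mathfrak{J}^C\oplus\mathfrak{J}^C\oplus C\oplus C$ with $\langle P,Q\rangle=\langle X,Z\rangle+\langle Y,W\rangle+(\tau\xi)\zeta+(\tau\eta)\omega$ for $P=(X,Y,\xi,\eta)$, $Q=(Z,W,\zeta,\omega)$. For $\phi\in{\mathfrak{e}_6}^C$, $A,B\in\mathfrak{J}^C$, $\nu\in C$ define $\varPhi(\phi,A,B,\nu):\mathfrak{P}^C\to\mathfrak{P}^C$ by $(X,Y,\xi,\eta)\mapsto(\phi X-\frac13\nu X+2B\times Y+\eta A,\ 2A\times X-{}^t\phi Y+\frac13\nu Y+\xi B,\ (A,Y)+\nu\xi,\ (B,X)-\nu\eta)$. Define $P\times Q=\varPhi(\phi,A,B,\nu)$ with $\phi=-\frac12(X\vee W+Z\vee Y)$, $A=-\frac14(2Y\times W-\xi Z-\zeta X)$, $B=\frac14(2X\times Z-\eta W-\omega Y)$, $\nu=\frac18((X,W)+(Z,Y)-3(\xi\omega+\zeta\eta))$. Then $E_7=\{\alpha\in\mathrm{Iso}_C(\mathfrak{P}^C)\mid\alpha(P\times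 Q)\alpha^{-1}=\alpha P\times\alpha Q,\ \langle\alpha P,\alpha Q\rangle=\langle P,Q\rangle\}$. Elements of $E_7$: $\sigma(X,Y,\xi,\eta)=(\sigma X,\sigma Y,\xi,\eta)$, where $\sigma\in E_6$ keeps $\xi_1,\xi_2,\xi_3,x_1$ and replaces $x_2,x_3$ by $-x_2,-x_3$; $\iota(X,Y,\xi,\eta)=(-iX,iY,-i\xi,i\eta)$. $Spin(10)$ is realized as $(E_6)_{E_1}=\{\alpha\in E_6\mid\alpha E_1=E_1\}$, $E_1=\mathrm{diag}(1,0,0)$. For $\theta\in U(1)=\{\theta\in C\mid(\tau\theta)\theta=1\}$, $\phi_1(\theta)\in E_6$ is the map $$\phi_1(\theta)X=\begin{pmatrix}\theta^4\xi_1&\theta x_3&\theta\overline{x}_2\\ \theta\overline{x}_3&\theta^{-2}\xi_2&\theta^{-2}x_1\\ \theta x_2&\theta^{-2}\overline{x}_1&\theta^{-2}\xi_3\end{pmatrix};$$ $\phi_1(i)$ and $\sigma=\phi_1(-1)$ are central elements of $Spin(10)=(E_6)_{E_1}$. *)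

theory Defs
  imports "HOL-Analysis.Analysis" "HOL-Algebra.Coset"
begin

section \<open>Octonions over a field of scalars\<close>

text \<open>
  The Cayley algebra is obtained from the scalars by three Cayley--Dickson doublings. With real
  scalars this is the division Cayley algebra (lemma \<open>real_octonion_division\<close>), with complex
  scalars it is its complexification, the multiplication being bilinear over the complex numbers
  (lemmas \<open>oct_cplx_mul\<close>, \<open>omul_cscale\<close>, \<open>oct_cplx_decomp\<close>). In particular the octonion
  conjugation \<open>oconj\<close> is linear over the complex numbers and is not the complex conjugation
  \<open>tau\<close> introduced below.
\<close>

type_synonym 'a oct = "(('a \<times> 'a) \<times> ('a \<times> 'a)) \<times> (('a \<times> 'a) \<times> ('a \<times> 'a))"

definition cd_mul ::
  "('a \<Rightarrow> 'a \<Rightarrow> 'a) \<Rightarrow> ('a \<Rightarrow> 'a) \<Rightarrow> 'a \<times> 'a \<Rightarrow> 'a \<times> 'a \<Rightarrow> ('a::ab_group_add) \<times> 'a" where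
  "cd_mul m j p q =
     (m (fst p) (fst q) - m (j (snd q)) (snd p), m (snd q) (fst p) + m (snd p) (j (fst q)))"

definition cd_conj :: "('a \<Rightarrow> 'a) \<Rightarrow> 'a \<times> 'a \<Rightarrow> ('a::ab_group_add) \<times> 'a" where
  "cd_conj j p = (j (fst p), - snd p)"

definition oconj :: "'a::real_field oct \<Rightarrow> 'a oct" where
  "oconj = cd_conj (cd_conj (cd_conj id))"

definition omul :: "'a::real_field oct \<Rightarrow> 'a oct \<Rightarrow> 'a oct" where
  "omul = cd_mul (cd_mul (cd_mul (*) id) (cd_conj id)) (cd_conj (cd_conj id))"

definition oct_of :: "'a::real_field \<Rightarrow> 'a oct" where
  "oct_of c = (((c, 0), (0, 0)), ((0, 0), (0, 0)))"

definition oct_re :: "'a oct \<Rightarrow> 'a" where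
  "oct_re x = fst (fst (fst x))"

lemma oct_cases [case_names coords]:
  obtains a b c d e f g h where "(x :: 'a oct) = (((a, b), (c, d)), ((e, f), (g, h)))"
  by (metis surj_pair)

lemma oct_inverse_left: "omul (oconj x) (omul x y) = omul (omul (oconj x) x) y"
proof -
  obtain x1 x2 x3 x4 x5 x6 x7 x8 where x: "x = (((x1, x2), (x3, x4)), ((x5, x6), (x7, x8)))"
    by (rule oct_cases)
  obtain y1 y2 y3 y4 y5 y6 y7 y8 where y: "y = (((y1, y2), (y3, y4)), ((y5, y6), (y7, y8)))"
    by (rule oct_cases)
  show ?thesis
    unfolding x y omul_def oconj_def cd_mul_def cd_conj_def fst_conv snd_conv id_apply prod.inject
      add_Pair diff_Pair uminus_Pair
    by (intro conjI; algebra)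
qed

lemma oct_inverse_right: "omul (omul y x) (oconj x) = omul y (omul x (oconj x))"
proof -
  obtain x1 x2 x3 x4 x5 x6 x7 x8 where x: "x = (((x1, x2), (x3, x4)), ((x5, x6), (x7, x8)))"
    by (rule oct_cases)
  obtain y1 y2 y3 y4 y5 y6 y7 y8 where y: "y = (((y1, y2), (y3, y4)), ((y5, y6), (y7, y8)))"
    by (rule oct_cases)
  show ?thesis
    unfolding x y omul_def oconj_def cd_mul_def cd_conj_def fst_conv snd_conv id_apply prod.inject
      add_Pair diff_Pair uminus_Pair
    by (intro conjI; algebra)
qed


section \<open>The Jordan algebra of hermitian octonionic matrices\<close>

text \<open>
  The tuple \<open>(\<xi>\<^sub>1, \<xi>\<^sub>2, \<xi>\<^sub>3, x\<^sub>1, x\<^sub>2, x\<^sub>3)\<close> stands for the matrix \<open>hmat\<close> of the tuple. By lemma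
  \<open>bij_hmat\<close> this identifies the tuples with the matrices that satisfy \<open>X\<^sup>* = X\<close>.
\<close>

type_synonym 'a jordan = "'a \<times> 'a \<times> 'a \<times> 'a oct \<times> 'a oct \<times> 'a oct"

type_synonym 'a omat = "'a oct ^ 3 ^ 3"

definition omat_mul :: "'a::real_field omat \<Rightarrow> 'a omat \<Rightarrow> 'a omat" where
  "omat_mul A B = (\<chi> i j. \<Sum>k\<in>UNIV. omul (A $ i $ k) (B $ k $ j))"

definition omat_adj :: "'a::real_field omat \<Rightarrow> 'a omat" where
  "omat_adj A = (\<chi> i j. oconj (A $ j $ i))"

definition hmat :: "'a::real_field jordan \<Rightarrow> 'a omat" where
  "hmat = (\<lambda>(\<xi>1, \<xi>2, \<xi>3, x1, x2, x3).
     vector [vector [oct_of \<xi>1, x3, oconj x2],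
             vector [oconj x3, oct_of \<xi>2, x1],
             vector [x2, oconj x1, oct_of \<xi>3]])"

definition jmul :: "'a::real_field jordan \<Rightarrow> 'a jordan \<Rightarrow> 'a jordan" where
  "jmul X Y = the_inv hmat ((1 / 2) *\<^sub>R (omat_mul (hmat X) (hmat Y) + omat_mul (hmat Y) (hmat X)))"

lemma oconj_oconj: "oconj (oconj x) = x"
  by (cases x) (auto simp: oconj_def cd_conj_def)

lemma oconj_oct_of: "oconj (oct_of c) = oct_of c"
  by (simp add: oconj_def cd_conj_def oct_of_def)

lemma oconj_add: "oconj (x + y) = oconj x + oconj y"
  by (cases x; cases y) (auto simp: oconj_def cd_conj_def)

lemma oconj_scaleR: "oconj (r *\<^sub>R x) = r *\<^sub>R oconj x"
  by (cases x) (auto simp: oconj_def cd_conj_def)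

lemma oconj_omul: "oconj (omul x y) = omul (oconj y) (oconj x)"
  by (cases x; cases y) (auto simp: omul_def oconj_def cd_mul_def cd_conj_def algebra_simps)

lemma oconj_eq_self_iff: "oconj x = x \<longleftrightarrow> x = oct_of (oct_re x)"
proof -
  have *: "- a = a \<longleftrightarrow> a = 0" for a :: 'a
    by (metis add.right_inverse mult_2 mult_eq_0_iff neg_0_equal_iff_equal zero_neq_numeral)
  show ?thesis
    by (cases x) (auto simp: oconj_def cd_conj_def oct_of_def oct_re_def *)
qed

lemma inj_hmat: "inj hmat"
proof (rule injI)
  fix X Y :: "'a jordan"
  assume "hmat X = hmat Y"
  then have "hmat X $ i $ j = hmat Y $ i $ j" for i j
    by simp
  from this[of 1 1] this[of 2 2] this[of 3 3] this[of 2 3] this[of 3 1] this[of 1 2]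
  show "X = Y"
    by (cases X rule: prod_cases6; cases Y rule: prod_cases6) (simp add: hmat_def oct_of_def)
qed

lemma omat_adj_hmat: "omat_adj (hmat X) = hmat X"
  by (cases X rule: prod_cases6)
    (simp add: vec_eq_iff forall_3 omat_adj_def hmat_def oconj_oct_of oconj_oconj)

lemma hmat_surj:
  fixes A :: "'a::real_field omat"
  assumes "omat_adj A = A"
  shows "A = hmat (oct_re (A $ 1 $ 1), oct_re (A $ 2 $ 2), oct_re (A $ 3 $ 3),
      A $ 2 $ 3, A $ 3 $ 1, A $ 1 $ 2)"
proof -
  have *: "oconj (A $ j $ i) = A $ i $ j" for i j
    using arg_cong[OF assms, of "\<lambda>A. A $ i $ j"] by (simp add: omat_adj_def)
  have d: "oct_of (oct_re (A $ i $ i)) = A $ i $ i" for i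
    by (rule sym[OF iffD1[OF oconj_eq_self_iff *]])
  show ?thesis
    by (simp add: vec_eq_iff forall_3 hmat_def d *)
qed

lemma range_hmat: "range hmat = {A. omat_adj A = A}"
  using omat_adj_hmat hmat_surj by (blast intro: range_eqI)

lemma bij_hmat: "bij_betw hmat UNIV {A. omat_adj A = A}"
  by (simp add: bij_betw_def inj_hmat range_hmat)

lemma hmat_jmul:
  "hmat (jmul X Y) = (1 / 2) *\<^sub>R (omat_mul (hmat X) (hmat Y) + omat_mul (hmat Y) (hmat X))"
proof -
  have o: "oconj (\<Sum>k\<in>UNIV. f k) = (\<Sum>k\<in>UNIV. oconj (f k))" for f :: "3 \<Rightarrow> 'a oct"
    by (simp add: sum_3 oconj_add)
  have m: "omat_adj (omat_mul A B) = omat_mul (omat_adj B) (omat_adj A)" for A B :: "'a omat"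
    by (simp add: vec_eq_iff omat_adj_def omat_mul_def o oconj_omul)
  have a: "omat_adj (r *\<^sub>R (A + B)) = r *\<^sub>R (omat_adj A + omat_adj B)" for A B :: "'a omat" and r
    by (simp add: vec_eq_iff omat_adj_def oconj_add oconj_scaleR)
  have "(1 / 2) *\<^sub>R (omat_mul (hmat X) (hmat Y) + omat_mul (hmat Y) (hmat X)) \<in> range hmat"
    unfolding range_hmat by (simp add: a m omat_adj_hmat add.commute)
  then show ?thesis
    unfolding jmul_def by (rule f_the_inv_into_f[OF inj_hmat])
qed


section \<open>Complex vector spaces with a complex conjugation\<close>

class cspace = real_vector +
  fixes cscale :: "complex \<Rightarrow> 'a \<Rightarrow> 'a"  (infixr \<open>*\<^sub>C\<close> 75)
    and tau :: "'a \<Rightarrow> 'a"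
  assumes cscale_add_right: "c *\<^sub>C (x + y) = c *\<^sub>C x + c *\<^sub>C y"
    and cscale_add_left: "(c + d) *\<^sub>C x = c *\<^sub>C x + d *\<^sub>C x"
    and cscale_cscale: "c *\<^sub>C d *\<^sub>C x = (c * d) *\<^sub>C x"
    and cscale_of_real: "of_real r *\<^sub>C x = r *\<^sub>R x"
    and tau_add: "tau (x + y) = tau x + tau y"
    and tau_cscale: "tau (c *\<^sub>C x) = cnj c *\<^sub>C tau x"
    and tau_tau: "tau (tau x) = x"

instantiation complex :: cspace
begin

definition cscale_complex :: "complex \<Rightarrow> complex \<Rightarrow> complex" where
  "cscale_complex c x = c * x"

definition tau_complex :: "complex \<Rightarrow> complex" where
  "tau_complex = cnj"

instance
  by standard (simp_all add: cscale_complex_def tau_complex_def algebra_simps scaleR_conv_of_real)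

end

instantiation prod :: (cspace, cspace) cspace
begin

definition cscale_prod :: "complex \<Rightarrow> 'a \<times> 'b \<Rightarrow> 'a \<times> 'b" where
  "cscale_prod c p = (c *\<^sub>C fst p, c *\<^sub>C snd p)"

definition tau_prod :: "'a \<times> 'b \<Rightarrow> 'a \<times> 'b" where
  "tau_prod p = (tau (fst p), tau (snd p))"

instance
  by standard
    (auto simp: cscale_prod_def tau_prod_def cscale_add_right cscale_add_left cscale_cscale
      cscale_of_real tau_add tau_cscale tau_tau scaleR_prod_def)

end

lemma cscale_Pair [simp]: "c *\<^sub>C (x, y) = (c *\<^sub>C x, c *\<^sub>C y)"
  by (simp add: cscale_prod_def)

lemma tau_Pair [simp]: "tau (x, y) = (tau x, tau y)"
  by (simp add: tau_prod_def)

definition clinear :: "('a::cspace \<Rightarrow> 'b::cspace) \<Rightarrow> bool" where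
  "clinear f \<longleftrightarrow> (\<forall>x y. f (x + y) = f x + f y) \<and> (\<forall>c x. f (c *\<^sub>C x) = c *\<^sub>C f x)"

definition oct_cplx :: "real oct \<Rightarrow> complex oct" where
  "oct_cplx = (\<lambda>(((a, b), (c, d)), ((e, f), (g, h))).
     (((of_real a, of_real b), (of_real c, of_real d)),
      ((of_real e, of_real f), (of_real g, of_real h))))"

definition jordan_cplx :: "real jordan \<Rightarrow> complex jordan" where
  "jordan_cplx = (\<lambda>(\<xi>1, \<xi>2, \<xi>3, x1, x2, x3).
     (of_real \<xi>1, of_real \<xi>2, of_real \<xi>3, oct_cplx x1, oct_cplx x2, oct_cplx x3))"

lemma oct_cplx_mul: "oct_cplx (omul x y) = omul (oct_cplx x) (oct_cplx y)"
  by (cases x; cases y) (auto simp: oct_cplx_def omul_def cd_mul_def cd_conj_def)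

lemma omul_cscale:
  fixes x y :: "complex oct"
  shows "omul (c *\<^sub>C x) y = c *\<^sub>C omul x y" "omul x (c *\<^sub>C y) = c *\<^sub>C omul x y"
proof -
  obtain x1 x2 x3 x4 x5 x6 x7 x8 where x: "x = (((x1, x2), (x3, x4)), ((x5, x6), (x7, x8)))"
    by (rule oct_cases)
  obtain y1 y2 y3 y4 y5 y6 y7 y8 where y: "y = (((y1, y2), (y3, y4)), ((y5, y6), (y7, y8)))"
    by (rule oct_cases)
  show "omul (c *\<^sub>C x) y = c *\<^sub>C omul x y" "omul x (c *\<^sub>C y) = c *\<^sub>C omul x y"
    unfolding x y
    by (simp only: omul_def cd_mul_def cd_conj_def cscale_Pair cscale_complex_def fst_conv snd_conv
      id_apply prod.inject add_Pair diff_Pair uminus_Pair; intro conjI; algebra)+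
qed

lemma oct_cplx_coords: "\<exists>a b. \<forall>x y. z = oct_cplx x + \<i> *\<^sub>C oct_cplx y \<longleftrightarrow> x = a \<and> y = b"
proof -
  obtain a b c d e f g h where z: "z = (((a, b), (c, d)), ((e, f), (g, h)))"
    by (metis surj_pair)
  show ?thesis
    unfolding z
    by (rule exI[of _ "(((Re a, Re b), (Re c, Re d)), ((Re e, Re f), (Re g, Re h)))"],
        rule exI[of _ "(((Im a, Im b), (Im c, Im d)), ((Im e, Im f), (Im g, Im h)))"])
      (auto simp: oct_cplx_def cscale_prod_def cscale_complex_def complex_eq_iff)
qed

lemma oct_cplx_decomp: "\<exists>!(x, y). z = oct_cplx x + \<i> *\<^sub>C oct_cplx y"
proof -
  obtain a b where *: "\<And>x y. z = oct_cplx x + \<i> *\<^sub>C oct_cplx y \<longleftrightarrow> x = a \<and> y = b"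
    using oct_cplx_coords by meson
  show ?thesis
    by (rule ex1I[of _ "(a, b)"]) (simp_all only: * split_paired_all case_prod_conv)
qed

lemma jordan_cplx_decomp: "\<exists>!(X, Y). Z = jordan_cplx X + \<i> *\<^sub>C jordan_cplx Y"
proof -
  obtain \<xi>1 \<xi>2 \<xi>3 x1 x2 x3 where Z: "Z = (\<xi>1, \<xi>2, \<xi>3, x1, x2, x3)"
    by (metis surj_pair)
  obtain a1 b1 where 1: "\<And>x y. x1 = oct_cplx x + \<i> *\<^sub>C oct_cplx y \<longleftrightarrow> x = a1 \<and> y = b1"
    using oct_cplx_coords by meson
  obtain a2 b2 where 2: "\<And>x y. x2 = oct_cplx x + \<i> *\<^sub>C oct_cplx y \<longleftrightarrow> x = a2 \<and> y = b2"
    using oct_cplx_coords by meson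
  obtain a3 b3 where 3: "\<And>x y. x3 = oct_cplx x + \<i> *\<^sub>C oct_cplx y \<longleftrightarrow> x = a3 \<and> y = b3"
    using oct_cplx_coords by meson
  have s: "z = of_real r + \<i> * of_real s \<longleftrightarrow> r = Re z \<and> s = Im z" for z r s
    by (auto simp: complex_eq_iff)
  have *: "Z = jordan_cplx X + \<i> *\<^sub>C jordan_cplx Y \<longleftrightarrow>
      X = (Re \<xi>1, Re \<xi>2, Re \<xi>3, a1, a2, a3) \<and> Y = (Im \<xi>1, Im \<xi>2, Im \<xi>3, b1, b2, b3)" for X Y
    unfolding Z
    by (cases X rule: prod_cases6; cases Y rule: prod_cases6)
      (simp only: jordan_cplx_def cscale_Pair cscale_complex_def case_prod_conv add_Pair
        prod.inject 1 2 3 s, blast)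
  show ?thesis
    by (rule ex1I[of _ "((Re \<xi>1, Re \<xi>2, Re \<xi>3, a1, a2, a3), (Im \<xi>1, Im \<xi>2, Im \<xi>3, b1, b2, b3))"])
      (simp_all only: * split_paired_all case_prod_conv)
qed

lemma real_octonion_division:
  fixes x z :: "real oct"
  assumes "x \<noteq> 0"
  shows "\<exists>!y. omul x y = z" "\<exists>!y. omul y x = z"
proof -
  obtain x1 x2 x3 x4 x5 x6 x7 x8 where x: "x = (((x1, x2), (x3, x4)), ((x5, x6), (x7, x8)))"
    by (rule oct_cases)
  define n where "n = x1 * x1 + x2 * x2 + x3 * x3 + x4 * x4 + x5 * x5 + x6 * x6 + x7 * x7 + x8 * x8"
  have nn: "0 \<le> x1 * x1" "0 \<le> x2 * x2" "0 \<le> x3 * x3" "0 \<le> x4 * x4"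
    "0 \<le> x5 * x5" "0 \<le> x6 * x6" "0 \<le> x7 * x7" "0 \<le> x8 * x8"
    by simp_all
  have n0: "n \<noteq> 0"
  proof
    assume "n = 0"
    then have "x1 * x1 = 0 \<and> x2 * x2 = 0 \<and> x3 * x3 = 0 \<and> x4 * x4 = 0 \<and>
      x5 * x5 = 0 \<and> x6 * x6 = 0 \<and> x7 * x7 = 0 \<and> x8 * x8 = 0"
      using nn unfolding n_def by linarith
    then show False
      using assms by (simp add: x flip: zero_prod_def)
  qed
  have n: "omul (oconj x) x = oct_of n" "omul x (oconj x) = oct_of n"
    by (simp_all add: x n_def omul_def oconj_def cd_mul_def cd_conj_def oct_of_def zero_prod_def)
  have l: "omul (oct_of r) y = r *\<^sub>R y" "omul y (oct_of r) = r *\<^sub>R y" for r and y :: "real oct"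
  proof -
    obtain y1 y2 y3 y4 y5 y6 y7 y8 where y: "y = (((y1, y2), (y3, y4)), ((y5, y6), (y7, y8)))"
      by (rule oct_cases)
    show "omul (oct_of r) y = r *\<^sub>R y" "omul y (oct_of r) = r *\<^sub>R y"
      by (simp_all add: y omul_def cd_mul_def cd_conj_def oct_of_def)
  qed
  have s: "omul u (r *\<^sub>R y) = r *\<^sub>R omul u y" "omul (r *\<^sub>R u) y = r *\<^sub>R omul u y"
    for r and u y :: "real oct"
  proof -
    obtain y1 y2 y3 y4 y5 y6 y7 y8 where y: "y = (((y1, y2), (y3, y4)), ((y5, y6), (y7, y8)))"
      by (rule oct_cases)
    obtain u1 u2 u3 u4 u5 u6 u7 u8 where u: "u = (((u1, u2), (u3, u4)), ((u5, u6), (u7, u8)))"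
      by (rule oct_cases)
    show "omul u (r *\<^sub>R y) = r *\<^sub>R omul u y" "omul (r *\<^sub>R u) y = r *\<^sub>R omul u y"
      unfolding u y
      by (simp only: omul_def cd_mul_def cd_conj_def scaleR_Pair real_scaleR_def fst_conv snd_conv
        id_apply prod.inject add_Pair diff_Pair uminus_Pair; intro conjI; algebra)+
  qed
  have 1: "omul (oconj x) (omul x y) = n *\<^sub>R y" "omul (omul y x) (oconj x) = n *\<^sub>R y" for y
    by (simp_all add: oct_inverse_left oct_inverse_right n l)
  have 2: "omul x (omul (oconj x) y) = n *\<^sub>R y" "omul (omul y (oconj x)) x = n *\<^sub>R y" for y
    using oct_inverse_left[of "oconj x" y] oct_inverse_right[of y "oconj x"]
    by (simp_all add: oconj_oconj n l)
  show "\<exists>!y. omul x y = z"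
  proof (rule ex1I[of _ "inverse n *\<^sub>R omul (oconj x) z"])
    show "omul x (inverse n *\<^sub>R omul (oconj x) z) = z"
      using n0 by (simp add: s 2)
    show "y = inverse n *\<^sub>R omul (oconj x) z" if "omul x y = z" for y
      using that n0 by (auto simp: 1)
  qed
  show "\<exists>!y. omul y x = z"
  proof (rule ex1I[of _ "inverse n *\<^sub>R omul z (oconj x)"])
    show "omul (inverse n *\<^sub>R omul z (oconj x)) x = z"
      using n0 by (simp add: s 2)
    show "y = inverse n *\<^sub>R omul z (oconj x)" if "omul y x = z" for y
      using that n0 by (auto simp: 1)
  qed
qed


section \<open>The structure of the complex exceptional Jordan algebra\<close>

type_synonym JC = "complex jordan"

definition jtr :: "JC \<Rightarrow> complex" where
  "jtr = (\<lambda>(\<xi>1, \<xi>2, \<xi>3, x1, x2, x3). \<xi>1 + \<xi>2 + \<xi>3)"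

definition jE :: JC where
  "jE = (1, 1, 1, 0, 0, 0)"

definition jE1 :: JC where
  "jE1 = (1, 0, 0, 0, 0, 0)"

definition jinner :: "JC \<Rightarrow> JC \<Rightarrow> complex" where
  "jinner X Y = jtr (jmul X Y)"

definition jcross :: "JC \<Rightarrow> JC \<Rightarrow> JC" where
  "jcross X Y = (1 / 2) *\<^sub>R (2 *\<^sub>R jmul X Y - jtr X *\<^sub>C Y - jtr Y *\<^sub>C X
     + (jtr X * jtr Y - jinner X Y) *\<^sub>C jE)"

definition jdet :: "JC \<Rightarrow> complex" where
  "jdet X = (1 / 3) * jinner X (jcross X X)"

definition jherm :: "JC \<Rightarrow> JC \<Rightarrow> complex" where
  "jherm X Y = jinner (tau X) Y"

definition jvee :: "JC \<Rightarrow> JC \<Rightarrow> JC \<Rightarrow> JC" where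
  "jvee X W U = ((1 / 2) * jinner W U) *\<^sub>C X + ((1 / 6) * jinner X W) *\<^sub>C U
     - 2 *\<^sub>R jcross W (jcross X U)"

text \<open>
  The transpose with respect to the symmetric form \<open>jinner\<close>, which is nondegenerate; see
  lemma \<open>jtransp_eqI\<close>.
\<close>

definition jtransp :: "(JC \<Rightarrow> JC) \<Rightarrow> JC \<Rightarrow> JC" where
  "jtransp \<phi> = (THE \<psi>. \<forall>X Y. jinner (\<phi> X) Y = jinner X (\<psi> Y))"

lemma jinner_coords:
  "jinner (\<xi>1, \<xi>2, \<xi>3, x1, x2, x3) (\<eta>1, \<eta>2, \<eta>3, y1, y2, y3) =
     \<xi>1 * \<eta>1 + \<xi>2 * \<eta>2 + \<xi>3 * \<eta>3 + 2 * (oct_re (omul x1 (oconj y1))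
       + oct_re (omul x2 (oconj y2)) + oct_re (omul x3 (oconj y3)))"
proof -
  let ?X = "(\<xi>1, \<xi>2, \<xi>3, x1, x2, x3)" and ?Y = "(\<eta>1, \<eta>2, \<eta>3, y1, y2, y3)"
  obtain \<zeta>1 \<zeta>2 \<zeta>3 z1 z2 z3 where Z: "jmul ?X ?Y = (\<zeta>1, \<zeta>2, \<zeta>3, z1, z2, z3)"
    by (metis surj_pair)
  have e: "oct_re (hmat (jmul ?X ?Y) $ i $ i) =
     (1 / 2) *\<^sub>R (oct_re (omat_mul (hmat ?X) (hmat ?Y) $ i $ i)
       + oct_re (omat_mul (hmat ?Y) (hmat ?X) $ i $ i))" for i
    unfolding hmat_jmul by (simp add: oct_re_def)
  have a: "oct_re (x + y) = oct_re x + oct_re y" for x y :: "complex oct"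
    by (simp add: oct_re_def)
  have b: "oct_re (omul (oct_of r) (oct_of s)) = r * s" for r s :: complex
    by (simp add: oct_re_def oct_of_def omul_def cd_mul_def cd_conj_def)
  have c: "oct_re (omul (oconj x) y) = oct_re (omul x (oconj y))"
      "oct_re (omul y (oconj x)) = oct_re (omul x (oconj y))" for x y :: "complex oct"
    by (cases x; cases y; auto simp: oct_re_def omul_def oconj_def cd_mul_def cd_conj_def algebra_simps)+
  have d: "oct_re (hmat (jmul ?X ?Y) $ 1 $ 1) = \<zeta>1" "oct_re (hmat (jmul ?X ?Y) $ 2 $ 2) = \<zeta>2"
    "oct_re (hmat (jmul ?X ?Y) $ 3 $ 3) = \<zeta>3"
    unfolding Z by (simp_all add: hmat_def oct_re_def oct_of_def)
  have "jinner ?X ?Y = \<zeta>1 + \<zeta>2 + \<zeta>3"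
    by (simp add: jinner_def jtr_def Z)
  also have "\<dots> = \<xi>1 * \<eta>1 + \<xi>2 * \<eta>2 + \<xi>3 * \<eta>3 + 2 * (oct_re (omul x1 (oconj y1))
       + oct_re (omul x2 (oconj y2)) + oct_re (omul x3 (oconj y3)))"
    unfolding d[symmetric] e
    by (simp add: omat_mul_def sum_3 hmat_def a b c(1) c(2)[of x1 y1] c(2)[of x2 y2]
        c(2)[of x3 y3] scaleR_conv_of_real algebra_simps)
  finally show ?thesis .
qed

lemma jinner_nondegenerate:
  assumes "\<And>X. jinner X Y = jinner X Z"
  shows "Y = Z"
proof -
  have o: "y = z" if "\<And>x. oct_re (omul x (oconj y)) = oct_re (omul x (oconj z))"
    for y z :: "complex oct"
    using that[of "(((1, 0), (0, 0)), ((0, 0), (0, 0)))"] that[of "(((0, 1), (0, 0)), ((0, 0), (0, 0)))"]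
      that[of "(((0, 0), (1, 0)), ((0, 0), (0, 0)))"] that[of "(((0, 0), (0, 1)), ((0, 0), (0, 0)))"]
      that[of "(((0, 0), (0, 0)), ((1, 0), (0, 0)))"] that[of "(((0, 0), (0, 0)), ((0, 1), (0, 0)))"]
      that[of "(((0, 0), (0, 0)), ((0, 0), (1, 0)))"] that[of "(((0, 0), (0, 0)), ((0, 0), (0, 1)))"]
    by (cases y; cases z) (auto simp: oct_re_def omul_def oconj_def cd_mul_def cd_conj_def)
  have z: "oct_re (omul 0 x) = 0" for x :: "complex oct"
    by (cases x) (auto simp: oct_re_def omul_def cd_mul_def cd_conj_def)
  obtain \<eta>1 \<eta>2 \<eta>3 y1 y2 y3 where Y: "Y = (\<eta>1, \<eta>2, \<eta>3, y1, y2, y3)"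
    by (metis surj_pair)
  obtain \<zeta>1 \<zeta>2 \<zeta>3 z1 z2 z3 where Z: "Z = (\<zeta>1, \<zeta>2, \<zeta>3, z1, z2, z3)"
    by (metis surj_pair)
  note * = assms[unfolded Y Z]
  have "y1 = z1"
    by (rule o) (use *[of "(0, 0, 0, _, 0, 0)"] in \<open>simp add: jinner_coords z\<close>)
  moreover have "y2 = z2"
    by (rule o) (use *[of "(0, 0, 0, 0, _, 0)"] in \<open>simp add: jinner_coords z\<close>)
  moreover have "y3 = z3"
    by (rule o) (use *[of "(0, 0, 0, 0, 0, _)"] in \<open>simp add: jinner_coords z\<close>)
  ultimately show ?thesis
    using *[of "(1, 0, 0, 0, 0, 0)"] *[of "(0, 1, 0, 0, 0, 0)"] *[of "(0, 0, 1, 0, 0, 0)"]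
    by (simp add: Y Z jinner_coords z)
qed

lemma jtransp_eqI:
  assumes "\<And>X Y. jinner (\<phi> X) Y = jinner X (\<psi> Y)"
  shows "jtransp \<phi> = \<psi>"
  unfolding jtransp_def
proof (rule the_equality)
  show "\<forall>X Y. jinner (\<phi> X) Y = jinner X (\<psi> Y)"
    using assms by blast
  show "\<psi>' = \<psi>" if "\<forall>X Y. jinner (\<phi> X) Y = jinner X (\<psi>' Y)" for \<psi>'
    using that assms by (intro ext jinner_nondegenerate) metis
qed


section \<open>The groups\<close>

definition comp_group :: "('a \<Rightarrow> 'a) set \<Rightarrow> ('a \<Rightarrow> 'a) monoid" where
  "comp_group A = \<lparr>carrier = A, mult = (\<circ>), one = id\<rparr>"

definition E6 :: "(JC \<Rightarrow> JC) set" where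
  "E6 = {\<alpha>. clinear \<alpha> \<and> bij \<alpha> \<and> (\<forall>X. jdet (\<alpha> X) = jdet X) \<and>
     (\<forall>X Y. jherm (\<alpha> X) (\<alpha> Y) = jherm X Y)}"

definition Spin10 :: "(JC \<Rightarrow> JC) monoid" where
  "Spin10 = comp_group {\<alpha> \<in> E6. \<alpha> jE1 = jE1}"

definition U1 :: "complex monoid" where
  "U1 = \<lparr>carrier = {\<theta>. tau \<theta> * \<theta> = 1}, mult = (*), one = 1\<rparr>"

definition phi1 :: "complex \<Rightarrow> JC \<Rightarrow> JC" where
  "phi1 \<theta> = (\<lambda>(\<xi>1, \<xi>2, \<xi>3, x1, x2, x3).
     (\<theta> ^ 4 * \<xi>1, inverse (\<theta>\<^sup>2) * \<xi>2, inverse (\<theta>\<^sup>2) * \<xi>3, inverse (\<theta>\<^sup>2) *\<^sub>C x1, \<theta> *\<^sub>C x2, \<theta> *\<^sub>C x3))"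

definition sigma6 :: "JC \<Rightarrow> JC" where
  "sigma6 = (\<lambda>(\<xi>1, \<xi>2, \<xi>3, x1, x2, x3). (\<xi>1, \<xi>2, \<xi>3, x1, - x2, - x3))"

type_synonym PC = "JC \<times> JC \<times> complex \<times> complex"

definition pherm :: "PC \<Rightarrow> PC \<Rightarrow> complex" where
  "pherm = (\<lambda>(X, Y, \<xi>, \<eta>) (Z, W, \<zeta>, \<omega>).
     jherm X Z + jherm Y W + tau \<xi> * \<zeta> + tau \<eta> * \<omega>)"

definition Phi :: "(JC \<Rightarrow> JC) \<Rightarrow> JC \<Rightarrow> JC \<Rightarrow> complex \<Rightarrow> PC \<Rightarrow> PC" where
  "Phi \<phi> A B \<nu> = (\<lambda>(X, Y, \<xi>, \<eta>).
     (\<phi> X - ((1 / 3) * \<nu>) *\<^sub>C X + 2 *\<^sub>R jcross B Y + \<eta> *\<^sub>C A,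
      2 *\<^sub>R jcross A X - jtransp \<phi> Y + ((1 / 3) * \<nu>) *\<^sub>C Y + \<xi> *\<^sub>C B,
      jinner A Y + \<nu> * \<xi>,
      jinner B X - \<nu> * \<eta>))"

text \<open>
  The operator \<open>jvee\<close> takes values in the Lie algebra of the linear maps \<open>\<phi>\<close> with
  \<open>jinner (\<phi> X) (jcross X X) = 0\<close>; the formula for \<open>Phi\<close> makes sense without this restriction
  on \<open>\<phi>\<close>, so it is not imposed.
\<close>

definition pcross :: "PC \<Rightarrow> PC \<Rightarrow> PC \<Rightarrow> PC" where
  "pcross = (\<lambda>(X, Y, \<xi>, \<eta>) (Z, W, \<zeta>, \<omega>).
     Phi (\<lambda>U. - ((1 / 2) *\<^sub>R (jvee X W U + jvee Z Y U)))
       (- ((1 / 4) *\<^sub>R (2 *\<^sub>R jcross Y W - \<xi> *\<^sub>C Z - \<zeta> *\<^sub>C X)))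
       ((1 / 4) *\<^sub>R (2 *\<^sub>R jcross X Z - \<eta> *\<^sub>C W - \<omega> *\<^sub>C Y))
       ((1 / 8) * (jinner X W + jinner Z Y - 3 * (\<xi> * \<omega> + \<zeta> * \<eta>))))"

definition E7 :: "(PC \<Rightarrow> PC) set" where
  "E7 = {\<alpha>. clinear \<alpha> \<and> bij \<alpha> \<and>
     (\<forall>P Q. \<alpha> \<circ> pcross P Q \<circ> inv_into UNIV \<alpha> = pcross (\<alpha> P) (\<alpha> Q)) \<and>
     (\<forall>P Q. pherm (\<alpha> P) (\<alpha> Q) = pherm P Q)}"

definition sigma7 :: "PC \<Rightarrow> PC" where
  "sigma7 = (\<lambda>(X, Y, \<xi>, \<eta>). (sigma6 X, sigma6 Y, \<xi>, \<eta>))"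

definition neg_sigma7 :: "PC \<Rightarrow> PC" where
  "neg_sigma7 P = - sigma7 P"

definition iota7 :: "PC \<Rightarrow> PC" where
  "iota7 = (\<lambda>(X, Y, \<xi>, \<eta>). ((- \<i>) *\<^sub>C X, \<i> *\<^sub>C Y, - \<i> * \<xi>, \<i> * \<eta>))"

definition E7_fixed :: "(PC \<Rightarrow> PC) \<Rightarrow> (PC \<Rightarrow> PC) set" where
  "E7_fixed \<gamma> = {\<alpha> \<in> E7. \<gamma> \<circ> \<alpha> \<circ> inv_into UNIV \<gamma> = \<alpha>}"

definition Z4 :: "(complex \<times> complex \<times> (JC \<Rightarrow> JC)) set" where
  "Z4 = {(1, 1, id), (1, - 1, sigma6), (1, \<i>, sigma6 \<circ> phi1 \<i>), (1, - \<i>, phi1 \<i>)}"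

definition Z3 :: "complex \<Rightarrow> (complex \<times> complex \<times> (JC \<Rightarrow> JC)) set" where
  "Z3 \<omega> = {(1, 1, id), (\<omega>, \<omega>, id), (\<omega>\<^sup>2, \<omega>\<^sup>2, id)}"


section \<open>Isomorphism of topological groups\<close>

definition quotient_topology :: "'a topology \<Rightarrow> ('a \<Rightarrow> 'b) \<Rightarrow> 'b topology" where
  "quotient_topology T p =
     topology (\<lambda>U. U \<subseteq> p ` topspace T \<and> openin T {x \<in> topspace T. p x \<in> U})"

lemma openin_quotient_topology:
  "openin (quotient_topology T p) U \<longleftrightarrow>
     U \<subseteq> p ` topspace T \<and> openin T {x \<in> topspace T. p x \<in> U}"
proof -
  have i: "{x \<in> topspace T. p x \<in> A \<inter> B} = {x \<in> topspace T. p x \<in> A} \<inter> {x \<in> topspace T. p x \<in> B}"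
    for A B by blast
  have u: "{x \<in> topspace T. p x \<in> \<Union>\<K>} = \<Union>((\<lambda>K. {x \<in> topspace T. p x \<in> K}) ` \<K>)" for \<K>
    by blast
  have "istopology (\<lambda>U. U \<subseteq> p ` topspace T \<and> openin T {x \<in> topspace T. p x \<in> U})"
    unfolding istopology_def i u by (auto intro!: openin_Union simp del: UN_simps)
  then show ?thesis
    unfolding quotient_topology_def by (simp add: topology_inverse')
qed

lemma quotient_map_quotient_topology: "quotient_map T (quotient_topology T p) p"
proof -
  have "{x \<in> topspace T. p x \<in> p ` topspace T} = topspace T"
    by blast
  then have "openin (quotient_topology T p) (p ` topspace T)"
    by (simp add: openin_quotient_topology)
  then have "topspace (quotient_topology T p) = p ` topspace T"
    by (meson openin_quotient_topology openin_subset openin_topspace subset_antisym)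
  then show ?thesis
    by (auto simp: quotient_map_def openin_quotient_topology)
qed

text \<open>
  Function types carry the topology of pointwise convergence. On a set of linear maps between
  finite-dimensional spaces it is the usual topology of the space of linear maps.
\<close>

definition quotient_top_iso ::
  "('a::topological_space) monoid \<Rightarrow> 'a set \<Rightarrow> ('b::topological_space) monoid \<Rightarrow> ('a set \<Rightarrow> 'b) \<Rightarrow> bool"
  where
  "quotient_top_iso G N H f \<longleftrightarrow> f \<in> iso (G Mod N) H \<and>
     homeomorphic_map
       (quotient_topology (top_of_set (carrier G)) (\<lambda>g. N #>\<^bsub>G\<^esub> g)) (top_of_set (carrier H)) f"

end

theory Submission
  imports Defs
begin

text \<open>
  An element of \<open>E\<^sub>7\<close> that commutes with \<open>\<iota>\<close> and \<open>\<sigma>\<close> maps the vector \<open>(0, 0, 1, 0)\<close> to some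
  \<open>(M, 0, \<mu>, 0)\<close> with \<open>\<sigma>M = M\<close>, \<open>\<mu>M = 0\<close> and \<open>M \<times> M = 0\<close>. If \<open>M \<noteq> 0\<close>, the space of the
  \<open>(Z, 0, \<zeta>, 0)\<close> whose product with \<open>(M, 0, \<mu>, 0)\<close> vanishes would have dimension greater than 1,
  but for \<open>(0, 0, 1, 0)\<close> it is a line. Hence \<open>M = 0\<close>, and unitarity makes the map diagonal:
  after division by \<open>\<phi>(\<theta>) = diag(\<theta>\<inverse>, \<theta>, \<theta>\<^sup>3, \<theta>\<^sup>-\<^sup>3)\<close> with \<open>\<theta>\<^sup>3 = \<mu>\<close> it comes from an element of
  \<open>E\<^sub>6\<close> that commutes with \<open>\<sigma>\<close>. By the same argument this element multiplies \<open>E\<^sub>1\<close> by a unit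
  scalar, and division by \<open>\<phi>\<^sub>1(t)\<close>, where \<open>t\<^sup>4\<close> is that scalar, leaves an element of \<open>Spin(10)\<close>.
  So \<open>(\<theta>, t, \<delta>) \<mapsto> \<phi>(\<theta>) \<phi>\<^sub>1(t) \<delta>\<close> is onto. It is a homomorphism because \<open>Spin(10)\<close> preserves the
  eigenspaces of \<open>\<phi>\<^sub>1(t)\<close>, and since the groups are compact its factorization is a homeomorphism.
\<close>

section \<open>The Jordan algebra in coordinates\<close>

interpretation cscale: vector_space "cscale :: complex \<Rightarrow> 'a::cspace \<Rightarrow> 'a"
proof
  show "1 *\<^sub>C x = x" for x :: 'a
    using cscale_of_real[of 1 x] by simp
qed (simp_all add: cscale_add_right cscale_add_left cscale_cscale)

lemma scaleR_cscale: "r *\<^sub>R x = of_real r *\<^sub>C x"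
  by (simp add: cscale_of_real)

text \<open>As \<open>oconj\<close> is complex linear, this is the complex bilinear extension of the
  Euclidean inner product; the hermitian one is \<open>odot (tau x) y\<close>.\<close>

definition odot :: "complex oct \<Rightarrow> complex oct \<Rightarrow> complex" where
  "odot x y = oct_re (omul x (oconj y))"

lemma odot_coords:
  "odot (((a1, a2), (a3, a4)), ((a5, a6), (a7, a8))) (((b1, b2), (b3, b4)), ((b5, b6), (b7, b8))) =
    a1 * b1 + a2 * b2 + a3 * b3 + a4 * b4 + a5 * b5 + a6 * b6 + a7 * b7 + a8 * b8"
  by (simp add: odot_def oct_re_def omul_def oconj_def cd_mul_def cd_conj_def algebra_simps)

lemma odot_commute: "odot x y = odot y x"
  by (cases x; cases y) (auto simp: odot_coords)

lemma odot_add: "odot (x + y) z = odot x z + odot y z" "odot x (y + z) = odot x y + odot x z"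
  by (cases x; cases y; cases z; auto simp: odot_coords algebra_simps)+

lemma odot_cscale: "odot (c *\<^sub>C x) y = c * odot x y" "odot x (c *\<^sub>C y) = c * odot x y"
  by (cases x; cases y; auto simp: odot_coords cscale_complex_def algebra_simps)+

lemma odot_0 [simp]: "odot 0 x = 0" "odot x 0 = 0"
  using odot_cscale(1)[of 0 x x] odot_cscale(2)[of x 0 x] by simp_all

lemma odot_tau: "odot (tau x) (tau y) = cnj (odot x y)"
  by (cases x; cases y) (auto simp: odot_coords tau_complex_def)

lemma odot_tau_self: "odot (tau x) x = of_real ((norm x)\<^sup>2)"
proof -
  have c: "cnj a * a = (of_real (cmod a))\<^sup>2" for a
    by (metis complex_norm_square mult.commute of_real_power)
  show ?thesis
    by (cases x rule: oct_cases) (simp add: odot_coords tau_complex_def norm_Pair c)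
qed

lemma omul_add:
  fixes x y z :: "complex oct"
  shows "omul (x + y) z = omul x z + omul y z" "omul x (y + z) = omul x y + omul x z"
  by (cases x; cases y; cases z; auto simp: omul_def cd_mul_def cd_conj_def algebra_simps)+

lemma omul_0 [simp]:
  fixes x :: "complex oct"
  shows "omul 0 x = 0" "omul x 0 = 0"
  using omul_cscale(1)[where c=0 and x=x and y=x] omul_cscale(2)[where c=0 and x=x and y=x] by simp_all

lemma oconj_cscale: "oconj (c *\<^sub>C x) = c *\<^sub>C oconj x" for x :: "complex oct"
  by (cases x) (auto simp: oconj_def cd_conj_def cscale_complex_def)

lemma oconj_0 [simp]: "oconj 0 = (0 :: complex oct)"
  using oconj_cscale[of 0 0] by simp

lemma oconj_tau: "oconj (tau x) = tau (oconj x)" for x :: "complex oct"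
  by (cases x) (auto simp: oconj_def cd_conj_def tau_complex_def)

lemma omul_tau: "omul (tau x) (tau y) = tau (omul x y)" for x y :: "complex oct"
  by (cases x; cases y) (auto simp: omul_def cd_mul_def cd_conj_def tau_complex_def)

text \<open>Both sides are the trilinear form Re((xy)z), whose cyclic invariance survives
  nonassociativity. It supplies the octonionic part of the symmetry of the determinant form.\<close>

lemma odot_omul_cyclic: "odot (oconj (omul x y)) z = odot (oconj (omul y z)) x"
proof -
  obtain x1 x2 x3 x4 x5 x6 x7 x8 where x: "x = (((x1, x2), (x3, x4)), ((x5, x6), (x7, x8)))"
    by (rule oct_cases)
  obtain y1 y2 y3 y4 y5 y6 y7 y8 where y: "y = (((y1, y2), (y3, y4)), ((y5, y6), (y7, y8)))"
    by (rule oct_cases)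
  obtain z1 z2 z3 z4 z5 z6 z7 z8 where z: "z = (((z1, z2), (z3, z4)), ((z5, z6), (z7, z8)))"
    by (rule oct_cases)
  show ?thesis
    unfolding x y z omul_def oconj_def cd_mul_def cd_conj_def fst_conv snd_conv id_apply
      add_Pair diff_Pair uminus_Pair odot_coords
    by algebra
qed

lemma omul_oct_of: "omul (oct_of c) x = c *\<^sub>C x" "omul x (oct_of c) = c *\<^sub>C x" for x :: "complex oct"
  by (cases x; auto simp: omul_def oct_of_def cd_mul_def cd_conj_def cscale_complex_def)+

lemma omul_oconj: "omul x (oconj y) + omul y (oconj x) = oct_of (2 * odot x y)"
    "omul (oconj x) y + omul (oconj y) x = oct_of (2 * odot x y)"
  by (cases x; cases y; auto simp: odot_coords omul_def oct_of_def oconj_def cd_mul_def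
    cd_conj_def algebra_simps)+

lemma oct_of_add: "oct_of a + oct_of b = oct_of (a + b)" for a :: complex
  by (simp add: oct_of_def)

lemma oct_of_scale: "c *\<^sub>C oct_of b = oct_of (c * b)"
  by (simp add: oct_of_def cscale_complex_def)

section \<open>Coordinates of the Jordan product, the inner product and the cross product\<close>

lemma jmul_coords:
  "jmul (\<xi>1, \<xi>2, \<xi>3, x1, x2, x3) (\<eta>1, \<eta>2, \<eta>3, y1, y2, y3) =
    (\<xi>1 * \<eta>1 + odot x2 y2 + odot x3 y3, \<xi>2 * \<eta>2 + odot x1 y1 + odot x3 y3,
     \<xi>3 * \<eta>3 + odot x1 y1 + odot x2 y2,
     (1 / 2) *\<^sub>C (oconj (omul x2 y3 + omul y2 x3) + (\<xi>2 + \<xi>3) *\<^sub>C y1 + (\<eta>2 + \<eta>3) *\<^sub>C x1),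
     (1 / 2) *\<^sub>C (oconj (omul x3 y1 + omul y3 x1) + (\<xi>3 + \<xi>1) *\<^sub>C y2 + (\<eta>3 + \<eta>1) *\<^sub>C x2),
     (1 / 2) *\<^sub>C (oconj (omul x1 y2 + omul y1 x2) + (\<xi>1 + \<xi>2) *\<^sub>C y3 + (\<eta>1 + \<eta>2) *\<^sub>C x3))"
  (is "jmul ?X ?Y = ?Z")
proof -
  let ?A = "omat_mul (hmat ?X) (hmat ?Y) + omat_mul (hmat ?Y) (hmat ?X)"
  have h: "(1 / 2) *\<^sub>R (u + v) = (1 / 2) *\<^sub>C u + (1 / 2) *\<^sub>C v" for u v :: "complex oct"
    by (simp add: scaleR_cscale cscale_add_right)
  \<comment> \<open>Regrouping puts each summand of one matrix product next to its counterpart from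
    the reversed product; on the diagonal \<open>omul_oconj\<close> then turns each pair into a
    scalar.\<close>
  have d: "a + b + c + (a' + b' + c') = (a + a') + (b + b') + (c + c')" for a b c a' b' c' ::
    "complex oct"
    by simp
  have "((1 / 2) *\<^sub>R ?A) $ i $ j = hmat ?Z $ i $ j" for i j
    using exhaust_3[of i] exhaust_3[of j]
    apply (elim disjE)
    apply (simp_all add: omat_mul_def sum_3 hmat_def omul_oct_of oct_of_add oct_of_scale d
      omul_oconj oconj_add oconj_cscale
       oconj_omul oconj_oconj scaleR_cscale cscale_add_right cscale_add_left cscale_cscale)
    apply (simp_all add: oct_of_def field_simps)
    done
  then have "(1 / 2) *\<^sub>R ?A = hmat ?Z"
    by (simp add: vec_eq_iff)
  then have "hmat (jmul ?X ?Y) = hmat ?Z"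
    by (simp add: hmat_jmul)
  then show ?thesis
    using inj_hmat by (meson injD)
qed

lemmas jinner_odot = jinner_coords[folded odot_def]

lemma jordan_cases [case_names coords]:
  obtains a b c x y z where "(X :: JC) = (a, b, c, x, y, z)"
  by (metis surj_pair)

lemma jinner_commute: "jinner X Y = jinner Y X"
  by (cases X rule: jordan_cases; cases Y rule: jordan_cases) (simp add: jinner_odot odot_commute)

lemma jinner_add: "jinner (X + Y) Z = jinner X Z + jinner Y Z" "jinner X (Y + Z) = jinner X Y +
  jinner X Z"
  by (cases X rule: jordan_cases; cases Y rule: jordan_cases; cases Z rule: jordan_cases;
      simp add: jinner_odot odot_add algebra_simps)+

lemma jinner_cscale: "jinner (c *\<^sub>C X) Y = c * jinner X Y" "jinner X (c *\<^sub>C Y) = c * jinner X Y"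
  by (cases X rule: jordan_cases; cases Y rule: jordan_cases;
      simp add: jinner_odot odot_cscale cscale_complex_def algebra_simps)+

lemma tau_0 [simp]: "tau 0 = (0 :: 'a :: cspace)"
  using tau_cscale[of 0 0] by simp

lemma tau_minus: "tau (- x) = - tau (x :: 'a :: cspace)"
  by (metis add.right_inverse minus_unique tau_0 tau_add)

lemma tau_diff: "tau (x - y) = tau x - tau (y :: 'a :: cspace)"
  by (metis diff_conv_add_uminus tau_add tau_minus)

text \<open>These are polarized 2 by 2 minors, so \<open>jcross X X\<close> is the adjugate of
  \<open>X\<close>.\<close>

lemma jcross_coords:
  "jcross (\<xi>1, \<xi>2, \<xi>3, x1, x2, x3) (\<eta>1, \<eta>2, \<eta>3, y1, y2, y3) = (1 / 2) *\<^sub>C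
    (\<xi>2 * \<eta>3 + \<xi>3 * \<eta>2 - 2 * odot x1 y1, \<xi>3 * \<eta>1 + \<xi>1 * \<eta>3 - 2 * odot x2 y2,
     \<xi>1 * \<eta>2 + \<xi>2 * \<eta>1 - 2 * odot x3 y3,
     oconj (omul x2 y3 + omul y2 x3) - \<xi>1 *\<^sub>C y1 - \<eta>1 *\<^sub>C x1,
     oconj (omul x3 y1 + omul y3 x1) - \<xi>2 *\<^sub>C y2 - \<eta>2 *\<^sub>C x2,
     oconj (omul x1 y2 + omul y1 x2) - \<xi>3 *\<^sub>C y3 - \<eta>3 *\<^sub>C x3)"
proof -
  \<comment> \<open>The trace terms cancel the two diagonal entries that the Jordan product
    contributes and leave the third one with a minus sign.\<close>
  have o: "(1 / 2) *\<^sub>C (2 *\<^sub>C (1 / 2) *\<^sub>C (z + (a + b) *\<^sub>C y + (c + d) *\<^sub>C x) - (e + a + b) *\<^sub>C y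
    - (f + c + d) *\<^sub>C x)
     = (1 / 2) *\<^sub>C (z - e *\<^sub>C y - f *\<^sub>C x)" for x y z :: "complex oct" and a b c d e f :: complex
    by (simp add: cscale_add_left cscale_cscale)
  show ?thesis
    by (simp add: jcross_def jmul_coords jtr_def jE_def scaleR_cscale jinner_odot)
      (simp add: cscale_complex_def field_simps o)
qed

lemma jcross_commute: "jcross X Y = jcross Y X"
  by (cases X rule: jordan_cases; cases Y rule: jordan_cases)
    (simp add: jcross_coords odot_commute algebra_simps)

lemma jcross_add: "jcross (X + Y) Z = jcross X Z + jcross Y Z" "jcross X (Y + Z) = jcross X Y +
  jcross X Z"
  by (cases X rule: jordan_cases; cases Y rule: jordan_cases; cases Z rule: jordan_cases;
      simp add: jcross_coords odot_add omul_add oconj_add cscale_add_left cscale_add_right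
      cscale.scale_right_diff_distrib cscale_complex_def field_simps)+

lemma jcross_cscale: "jcross (c *\<^sub>C X) Y = c *\<^sub>C jcross X Y" "jcross X (c *\<^sub>C Y) = c *\<^sub>C jcross X Y"
  by (cases X rule: jordan_cases; cases Y rule: jordan_cases;
      simp add: jcross_coords odot_cscale omul_cscale oconj_cscale cscale_add_right oconj_add
      cscale.scale_right_diff_distrib cscale_cscale cscale_complex_def field_simps)+

lemma jcross_tau: "jcross (tau X) (tau Y) = tau (jcross X Y)"
  by (cases X rule: jordan_cases; cases Y rule: jordan_cases)
     (simp add: jcross_coords odot_tau omul_tau oconj_tau tau_cscale tau_diff tau_add
       tau_complex_def cscale_complex_def oconj_add)

lemma odot_diff: "odot (x - y) z = odot x z - odot y z" "odot z (x - y) = odot z x - odot z y"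
  by (metis add_diff_cancel odot_add diff_add_cancel)+

text \<open>With commutativity this makes (X \<times> Y, Z) a symmetric trilinear form, the
  polarized determinant up to a factor. The octonionic terms match by cyclicity.\<close>

lemma jcross_jinner: "jinner (jcross X Y) Z = jinner X (jcross Y Z)"
proof -
  obtain \<xi>1 \<xi>2 \<xi>3 x1 x2 x3 where X: "X = (\<xi>1, \<xi>2, \<xi>3, x1, x2, x3)" by (rule jordan_cases)
  obtain \<eta>1 \<eta>2 \<eta>3 y1 y2 y3 where Y: "Y = (\<eta>1, \<eta>2, \<eta>3, y1, y2, y3)" by (rule jordan_cases)
  obtain \<zeta>1 \<zeta>2 \<zeta>3 z1 z2 z3 where Z: "Z = (\<zeta>1, \<zeta>2, \<zeta>3, z1, z2, z3)" by (rule jordan_cases)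
  have c: "odot (oconj (omul y2 z3)) x1 = odot (oconj (omul x1 y2)) z3"
          "odot (oconj (omul y3 z1)) x2 = odot (oconj (omul x2 y3)) z1"
          "odot (oconj (omul y1 z2)) x3 = odot (oconj (omul x3 y1)) z2"
          "odot (oconj (omul z2 y3)) x1 = odot (oconj (omul y3 x1)) z2"
          "odot (oconj (omul z3 y1)) x2 = odot (oconj (omul y1 x2)) z3"
          "odot (oconj (omul z1 y2)) x3 = odot (oconj (omul y2 x3)) z1"
    by (metis odot_omul_cyclic)+
  have d: "odot x (c *\<^sub>C y) = c * odot x y" "odot (c *\<^sub>C x) y = c * odot x y" for c x y
    by (rule odot_cscale)+
  show ?thesis
    unfolding X Y Z
    by (simp add: jcross_coords jinner_odot cscale_complex_def d odot_diff odot_add oconj_add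
      odot_commute[of _ "oconj _"] c) (simp add: odot_commute field_simps)
qed

lemma jinner_diff: "jinner (X - Y) Z = jinner X Z - jinner Y Z" "jinner Z (X - Y) = jinner Z X -
  jinner Z Y"
  by (metis add_diff_cancel jinner_add diff_add_cancel)+

text \<open>Moving both cross products across the form exchanges \<open>X\<close> and
  \<open>W\<close>. This identifies the transpose hidden in \<open>pcross\<close>.\<close>

lemma jinner_jvee: "jinner (jvee X W U) V = jinner U (jvee W X V)"
proof -
  have "jinner (jcross W (jcross X U)) V = jinner U (jcross X (jcross W V))"
    by (metis jcross_commute jcross_jinner jinner_commute)
  then show ?thesis
    by (simp add: jvee_def jinner_add jinner_diff jinner_cscale scaleR_cscale)
       (simp add: jinner_commute algebra_simps)
qed

text \<open>Replaces the description operator in \<open>jtransp\<close> by an explicit map, so that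
  products can be evaluated at chosen vectors.\<close>

lemma pcross_coords:
  "pcross (X, Y, \<xi>, \<eta>) (Z, W, \<zeta>, \<omega>) (U, V, \<kappa>, \<mu>) =
   (let A = (1 / 4) *\<^sub>C (\<xi> *\<^sub>C Z + \<zeta> *\<^sub>C X) - (1 / 2) *\<^sub>C jcross Y W;
        B = (1 / 2) *\<^sub>C jcross X Z - (1 / 4) *\<^sub>C (\<eta> *\<^sub>C W + \<omega> *\<^sub>C Y);
        \<nu> = (1 / 8) * (jinner X W + jinner Z Y - 3 * (\<xi> * \<omega> + \<zeta> * \<eta>))
    in (2 *\<^sub>C jcross B V + \<mu> *\<^sub>C A - (1 / 2) *\<^sub>C (jvee X W U + jvee Z Y U) - (\<nu> / 3) *\<^sub>C U,
        2 *\<^sub>C jcross A U + \<kappa> *\<^sub>C B + (1 / 2) *\<^sub>C (jvee W X V + jvee Y Z V) + (\<nu> / 3) *\<^sub>C V,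
        jinner A V + \<nu> * \<kappa>, jinner B U - \<nu> * \<mu>))"
proof -
  let ?A = "(1 / 4) *\<^sub>C (\<xi> *\<^sub>C Z + \<zeta> *\<^sub>C X) - (1 / 2) *\<^sub>C jcross Y W"
  let ?B = "(1 / 2) *\<^sub>C jcross X Z - (1 / 4) *\<^sub>C (\<eta> *\<^sub>C W + \<omega> *\<^sub>C Y)"
  have t: "jtransp (\<lambda>U. - ((1 / 2) *\<^sub>R (jvee X W U + jvee Z Y U))) =
    (\<lambda>V. - ((1 / 2) *\<^sub>R (jvee W X V + jvee Y Z V)))"
    by (rule jtransp_eqI)
       (simp add: scaleR_cscale jinner_cscale jinner_add jinner_jvee flip: cscale.scale_minus_left)
  have A: "- ((1 / 4) *\<^sub>R (2 *\<^sub>R jcross Y W - \<xi> *\<^sub>C Z - \<zeta> *\<^sub>C X)) = ?A"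
   and B: "(1 / 4) *\<^sub>R (2 *\<^sub>R jcross X Z - \<eta> *\<^sub>C W - \<omega> *\<^sub>C Y) = ?B"
    by (simp_all add: scaleR_cscale cscale.scale_right_diff_distrib cscale_add_right cscale_cscale
      algebra_simps)
  define n where "n = (1 / 8) * (jinner X W + jinner Z Y - 3 * (\<xi> * \<omega> + \<zeta> * \<eta>))"
  show ?thesis
    unfolding pcross_def prod.case A B Phi_def t Let_def n_def[symmetric]
    by (simp add: scaleR_cscale algebra_simps)
qed

section \<open>The groups of type \<open>E\<^sub>6\<close> and \<open>E\<^sub>7\<close>\<close>

lemma clinear_add: "clinear f \<Longrightarrow> f (x + y) = f x + f y"
  by (simp add: clinear_def)

lemma clinear_cscale: "clinear f \<Longrightarrow> f (c *\<^sub>C x) = c *\<^sub>C f x"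
  by (simp add: clinear_def)

lemma clinear_linear: "clinear f \<Longrightarrow> linear f"
  by (rule linearI) (simp_all add: clinear_def flip: cscale_of_real)

lemma clinear_diff: "clinear f \<Longrightarrow> f (x - y) = f x - f y"
  by (rule linear_diff[OF clinear_linear])

lemma clinear_0: "clinear f \<Longrightarrow> f 0 = 0"
  by (rule linear_0[OF clinear_linear])

lemma clinear_comp: "clinear f \<Longrightarrow> clinear g \<Longrightarrow> clinear (f \<circ> g)"
  by (simp add: clinear_def)

lemma clinear_inv:
  assumes "clinear f" "bij f"
  shows "clinear (inv_into UNIV f)"
  using assms unfolding clinear_def
  by (metis bij_inv_eq_iff)

text \<open>For \<open>f\<close> in E6, preservation of the hermitian form makes this the
  contragredient map, the inverse of the transpose.\<close>

definition cstar :: "('a::cspace \<Rightarrow> 'b::cspace) \<Rightarrow> 'a \<Rightarrow> 'b" where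
  "cstar f x = tau (f (tau x))"

lemma clinear_cstar: "clinear f \<Longrightarrow> clinear (cstar f)"
  by (simp add: clinear_def cstar_def tau_add tau_cscale)

lemma jherm_self:
  "jherm (a, b, c, x, y, z) (a, b, c, x, y, z) =
    of_real ((norm a)\<^sup>2 + (norm b)\<^sup>2 + (norm c)\<^sup>2 + 2 * ((norm x)\<^sup>2 + (norm y)\<^sup>2 + (norm z)\<^sup>2))"
proof -
  have c: "cnj a * a = (of_real (cmod a))\<^sup>2" for a
    by (metis complex_norm_square mult.commute of_real_power)
  show ?thesis
    by (simp add: jherm_def jinner_odot odot_tau_self tau_complex_def c)
qed

text \<open>The hermitian form counts each off-diagonal octonion twice and so dominates the
  Euclidean norm. This gives positive definiteness here and the compactness of \<open>Spin10\<close>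
  later.\<close>

lemma norm_le_jherm: "(norm X)\<^sup>2 \<le> Re (jherm X X)"
  by (cases X rule: jordan_cases) (simp add: jherm_self norm_Pair)

lemma norm_le_pherm: "(norm P)\<^sup>2 \<le> Re (pherm P P)"
proof -
  have c: "Re (cnj a * a) = (cmod a)\<^sup>2" for a
    using complex_norm_square[of a] by (metis Re_complex_of_real mult.commute)
  obtain X Y \<xi> \<eta> where "P = (X, Y, \<xi>, \<eta>)"
    by (metis surj_pair)
  then show ?thesis
    using norm_le_jherm[of X] norm_le_jherm[of Y] c[of \<xi>] c[of \<eta>]
    by (simp add: pherm_def norm_Pair tau_complex_def)
qed

text \<open>Positive definiteness gives injectivity, and finite dimension then gives
  surjectivity.\<close>

lemma bij_of_jherm:
  assumes f: "clinear f" and h: "\<And>X. jherm (f X) (f X) = jherm X X"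
  shows "bij f"
proof -
  have "X = 0" if "f X = 0" for X
    using norm_le_jherm[of X] h[of X] h[of 0] clinear_0[OF f] that jherm_self[of 0 0 0 0 0 0]
    by (simp flip: zero_prod_def)
  then have "inj f"
    using clinear_linear[OF f] linear_injective_0 by blast
  then show ?thesis
    using linear_injective_imp_surjective[OF clinear_linear[OF f]] by (simp add: bij_def)
qed

lemma bij_of_pherm:
  assumes f: "clinear f" and h: "\<And>P. pherm (f P) (f P) = pherm P P"
  shows "bij f"
proof -
  have 0: "pherm 0 0 = 0"
    using jherm_self[of 0 0 0 0 0 0] by (simp add: pherm_def zero_prod_def)
  have "P = 0" if "f P = 0" for P
    using norm_le_pherm[of P] h[of P] h[of 0] clinear_0[OF f] that 0 by simp
  then have "inj f"
    using clinear_linear[OF f] linear_injective_0 by blast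
  then show ?thesis
    using linear_injective_imp_surjective[OF clinear_linear[OF f]] by (simp add: bij_def)
qed

section \<open>The group E6 and its action on the cross product\<close>

lemma E6_clinear: "\<alpha> \<in> E6 \<Longrightarrow> clinear \<alpha>" and E6_bij: "\<alpha> \<in> E6 \<Longrightarrow> bij \<alpha>"
  unfolding E6_def by blast+

lemma E6_jdet: "\<alpha> \<in> E6 \<Longrightarrow> jdet (\<alpha> X) = jdet X"
  and E6_jherm: "\<alpha> \<in> E6 \<Longrightarrow> jherm (\<alpha> X) (\<alpha> Y) = jherm X Y"
  unfolding E6_def by blast+

lemma E6_jinner: "\<alpha> \<in> E6 \<Longrightarrow> jinner (\<alpha> X) (cstar \<alpha> Y) = jinner X Y"
  using E6_jherm[of \<alpha> "tau Y" X] by (simp add: jherm_def cstar_def tau_tau jinner_commute)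

lemma E6_jinner_left: "\<alpha> \<in> E6 \<Longrightarrow> jinner (cstar \<alpha> X) (\<alpha> Y) = jinner X Y"
  by (metis E6_jinner jinner_commute)

text \<open>Preserving the cubic determinant means preserving its polarization (X, Y \<times> Z).
  Since \<open>cstar \<alpha>\<close> is contragredient to \<alpha>, nondegeneracy determines the
  product of the images.\<close>

lemma E6_jcross:
  assumes \<alpha>: "\<alpha> \<in> E6"
  shows "jcross (\<alpha> X) (\<alpha> Y) = cstar \<alpha> (jcross X Y)"
proof -
  define T where "T X Y Z = jinner X (jcross Y Z)" for X Y Z
  define D where "D X = T X X X" for X
  have T: "T X Y Z = T Y X Z" "T X Y Z = T X Z Y" for X Y Z
    unfolding T_def by (metis jcross_commute jcross_jinner jinner_commute)+
  \<comment> \<open>The polarization identity of a symmetric cubic form.\<close>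
  have pol: "6 * T X Y Z = D (X + Y + Z) - D (X + Y) - D (Y + Z) - D (X + Z) + D X + D Y + D Z"
    for X Y Z
  proof -
    have a: "T (U + V) X Y = T U X Y + T V X Y" "T X (U + V) Y = T X U Y + T X V Y"
         "T X Y (U + V) = T X Y U + T X Y V" for U V X Y
      by (simp_all add: T_def jinner_add jcross_add)
    show ?thesis
      unfolding D_def by (simp add: a T)
  qed
  have D: "D (\<alpha> X) = D X" for X
    using E6_jdet[OF \<alpha>, of X] by (simp add: D_def T_def jdet_def)
  have "6 * T (\<alpha> X) (\<alpha> Y) (\<alpha> Z) = 6 * T X Y Z" for X Y Z
    unfolding pol by (simp add: D flip: clinear_add[OF E6_clinear[OF \<alpha>]])
  then have "jinner (\<alpha> Z) (jcross (\<alpha> X) (\<alpha> Y)) = jinner (\<alpha> Z) (cstar \<alpha> (jcross X Y))" for Z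
    by (simp add: T_def E6_jinner[OF \<alpha>])
  then show ?thesis
    using E6_bij[OF \<alpha>] by (intro jinner_nondegenerate) (metis bij_pointE)
qed

lemma E6I:
  assumes \<alpha>: "clinear \<alpha>" and i: "\<And>X Y. jinner (\<alpha> X) (cstar \<alpha> Y) = jinner X Y"
    and c: "\<And>X Y. jcross (\<alpha> X) (\<alpha> Y) = cstar \<alpha> (jcross X Y)"
  shows "\<alpha> \<in> E6"
proof -
  have h: "jherm (\<alpha> X) (\<alpha> Y) = jherm X Y" for X Y
    using i[of Y "tau X"] by (simp add: jherm_def cstar_def tau_tau jinner_commute)
  have d: "jdet (\<alpha> X) = jdet X" for X
    by (simp add: jdet_def i c)
  show ?thesis
    unfolding E6_def using \<alpha> h bij_of_jherm[OF \<alpha> h] d by blast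
qed

lemma E6I_jdet:
  assumes "clinear \<alpha>" "bij \<alpha>" "\<And>X. jdet (\<alpha> X) = jdet X" "\<And>X Y. jherm (\<alpha> X) (\<alpha> Y) = jherm X Y"
  shows "\<alpha> \<in> E6"
  unfolding E6_def using assms by blast

lemma E6_comp: "\<alpha> \<in> E6 \<Longrightarrow> \<beta> \<in> E6 \<Longrightarrow> \<alpha> \<circ> \<beta> \<in> E6"
  by (rule E6I_jdet) (simp_all add: clinear_comp bij_comp E6_clinear E6_bij E6_jdet E6_jherm)

lemma E6_id: "id \<in> E6"
  by (rule E6I_jdet) (simp_all add: clinear_def)

lemma E6_inv:
  assumes \<alpha>: "\<alpha> \<in> E6"
  shows "inv_into UNIV \<alpha> \<in> E6"
proof -
  have *: "\<alpha> (inv_into UNIV \<alpha> X) = X" for X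
    using E6_bij[OF assms] by (simp add: bij_is_surj surj_f_inv_f)
  show ?thesis
  proof (rule E6I_jdet)
    show "clinear (inv_into UNIV \<alpha>)" "bij (inv_into UNIV \<alpha>)"
      using \<alpha> by (simp_all add: E6_bij E6_clinear clinear_inv bij_imp_bij_inv)
    show "jdet (inv_into UNIV \<alpha> X) = jdet X" for X
      using E6_jdet[OF \<alpha>, of "inv_into UNIV \<alpha> X"] by (simp add: *)
    show "jherm (inv_into UNIV \<alpha> X) (inv_into UNIV \<alpha> Y) = jherm X Y" for X Y
      using E6_jherm[OF \<alpha>, of "inv_into UNIV \<alpha> X" "inv_into UNIV \<alpha> Y"] by (simp add: *)
  qed
qed

section \<open>The group E7 and its subgroups E6 and U(1)\<close>

lemma E7_clinear: "\<alpha> \<in> E7 \<Longrightarrow> clinear \<alpha>" and E7_bij: "\<alpha> \<in> E7 \<Longrightarrow> bij \<alpha>"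
  and E7_pherm: "\<alpha> \<in> E7 \<Longrightarrow> pherm (\<alpha> P) (\<alpha> Q) = pherm P Q"
  unfolding E7_def by blast+

lemma E7_pcross:
  assumes "\<alpha> \<in> E7"
  shows "\<alpha> (pcross P Q R) = pcross (\<alpha> P) (\<alpha> Q) (\<alpha> R)"
proof -
  have "\<alpha> \<circ> pcross P Q \<circ> inv_into UNIV \<alpha> = pcross (\<alpha> P) (\<alpha> Q)"
    using assms unfolding E7_def by blast
  from fun_cong[OF this, of "\<alpha> R"] show ?thesis
    using E7_bij[OF assms] by (simp add: bij_is_inj)
qed

lemma E7I:
  assumes \<alpha>: "clinear \<alpha>" and h: "\<And>P Q. pherm (\<alpha> P) (\<alpha> Q) = pherm P Q"
    and p: "\<And>P Q R. \<alpha> (pcross P Q R) = pcross (\<alpha> P) (\<alpha> Q) (\<alpha> R)"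
  shows "\<alpha> \<in> E7"
proof -
  have b: "bij \<alpha>"
    by (rule bij_of_pherm[OF \<alpha> h])
  have "\<alpha> \<circ> pcross P Q \<circ> inv_into UNIV \<alpha> = pcross (\<alpha> P) (\<alpha> Q)" for P Q
    by (rule ext) (simp only: o_apply p surj_f_inv_f[OF bij_is_surj[OF b]])
  then show ?thesis
    using \<alpha> h b unfolding E7_def by blast
qed

lemma E7_comp: "\<alpha> \<in> E7 \<Longrightarrow> \<beta> \<in> E7 \<Longrightarrow> \<alpha> \<circ> \<beta> \<in> E7"
  by (rule E7I) (simp_all add: clinear_comp E7_clinear E7_pherm E7_pcross)

text \<open>The standard embedding of E6 in E7. The two copies of the Jordan algebra are dual to
  each other, hence the contragredient action on the second.\<close>

definition jlift :: "(JC \<Rightarrow> JC) \<Rightarrow> PC \<Rightarrow> PC" where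
  "jlift \<alpha> = (\<lambda>(X, Y, \<xi>, \<eta>). (\<alpha> X, cstar \<alpha> Y, \<xi>, \<eta>))"

text \<open>The circle in E7 that commutes with the lifted E6; its element at \<i> is
  \<open>iota7\<close>.\<close>

definition pscale :: "complex \<Rightarrow> PC \<Rightarrow> PC" where
  "pscale \<theta> = (\<lambda>(X, Y, \<xi>, \<eta>). (inverse \<theta> *\<^sub>C X, \<theta> *\<^sub>C Y, \<theta> ^ 3 * \<xi>, inverse \<theta> ^ 3 * \<eta>))"

lemma cstar_jcross:
  assumes \<alpha>: "\<alpha> \<in> E6"
  shows "jcross (cstar \<alpha> X) (cstar \<alpha> Y) = \<alpha> (jcross X Y)"
  using E6_jcross[OF \<alpha>, of "tau X" "tau Y"] by (simp add: cstar_def jcross_tau tau_tau)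

lemma E6_jvee:
  assumes \<alpha>: "\<alpha> \<in> E6"
  shows "jvee (\<alpha> X) (cstar \<alpha> W) (\<alpha> U) = \<alpha> (jvee X W U)"
    "jvee (cstar \<alpha> W) (\<alpha> X) (cstar \<alpha> U) = cstar \<alpha> (jvee W X U)"
  using E6_clinear[OF \<alpha>] clinear_cstar[OF E6_clinear[OF \<alpha>]]
  by (simp_all add: jvee_def scaleR_cscale E6_jcross[OF \<alpha>] cstar_jcross[OF \<alpha>] E6_jinner[OF \<alpha>]
     E6_jinner_left[OF \<alpha>] clinear_add clinear_diff clinear_cscale)

text \<open>All ingredients of \<open>pcross\<close> are equivariant: the parameter A transforms by
  \<alpha>, B by \<open>cstar \<alpha>\<close>, \<open>jvee\<close> by conjugation, and \<nu> is
  invariant.\<close>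

lemma jlift_E7:
  assumes \<alpha>: "\<alpha> \<in> E6"
  shows "jlift \<alpha> \<in> E7"
proof (rule E7I)
  note l = E6_clinear[OF \<alpha>]
  note l' = clinear_cstar[OF l]
  note * = clinear_add[OF l] clinear_cscale[OF l] clinear_diff[OF l] clinear_add[OF l']
    clinear_cscale[OF l'] clinear_diff[OF l']
  show "clinear (jlift \<alpha>)"
    using l l' by (auto simp: clinear_def jlift_def)
  have h: "jherm (\<alpha> X) (\<alpha> Y) = jherm X Y" "jherm (cstar \<alpha> X) (cstar \<alpha> Y) = jherm X Y" for X Y
    using E6_jinner[OF \<alpha>, of Y "tau X"] E6_jinner[OF \<alpha>, of "tau X" Y]
    by (simp_all add: jherm_def cstar_def tau_tau jinner_commute)
  show "pherm (jlift \<alpha> P) (jlift \<alpha> Q) = pherm P Q" for P Q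
    by (auto simp: pherm_def jlift_def h split: prod.splits)
  show "jlift \<alpha> (pcross P Q R) = pcross (jlift \<alpha> P) (jlift \<alpha> Q) (jlift \<alpha> R)" for P Q R
  proof -
    obtain X Y \<xi> \<eta> where P: "P = (X, Y, \<xi>, \<eta>)" by (metis surj_pair)
    obtain Z W \<zeta> \<omega> where Q: "Q = (Z, W, \<zeta>, \<omega>)" by (metis surj_pair)
    obtain U V \<kappa> \<mu> where R: "R = (U, V, \<kappa>, \<mu>)" by (metis surj_pair)
    define A where "A = (1 / 4) *\<^sub>C (\<xi> *\<^sub>C Z + \<zeta> *\<^sub>C X) - (1 / 2) *\<^sub>C jcross Y W"
    define B where "B = (1 / 2) *\<^sub>C jcross X Z - (1 / 4) *\<^sub>C (\<eta> *\<^sub>C W + \<omega> *\<^sub>C Y)"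
    have A: "(1 / 4) *\<^sub>C (\<xi> *\<^sub>C \<alpha> Z + \<zeta> *\<^sub>C \<alpha> X) - (1 / 2) *\<^sub>C \<alpha> (jcross Y W) = \<alpha> A"
      and B: "(1 / 2) *\<^sub>C cstar \<alpha> (jcross X Z) - (1 / 4) *\<^sub>C (\<eta> *\<^sub>C cstar \<alpha> W + \<omega> *\<^sub>C cstar \<alpha> Y) =
        cstar \<alpha> B"
      by (simp_all add: A_def B_def *)
    show ?thesis
      unfolding P Q R jlift_def prod.case pcross_coords Let_def
        E6_jcross[OF \<alpha>] cstar_jcross[OF \<alpha>] E6_jinner[OF \<alpha>] E6_jvee[OF \<alpha>]
        A B A_def[symmetric] B_def[symmetric]
      by (simp add: E6_jinner[OF \<alpha>] E6_jinner_left[OF \<alpha>] E6_jcross[OF \<alpha>] cstar_jcross[OF \<alpha>] *)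
  qed
qed

lemma pscale_E7:
  assumes t: "tau \<theta> * \<theta> = 1"
  shows "pscale \<theta> \<in> E7"
proof (rule E7I)
  have n: "\<theta> \<noteq> 0" using t by auto
  have i: "cnj \<theta> = inverse \<theta>"
    using t n by (metis inverse_unique mult.commute tau_complex_def)
  show "clinear (pscale \<theta>)"
    by (auto simp: clinear_def pscale_def cscale_add_right cscale_cscale cscale_complex_def
      algebra_simps)
  show "pherm (pscale \<theta> P) (pscale \<theta> Q) = pherm P Q" for P Q
    using n by (auto simp: pherm_def pscale_def jherm_def jinner_cscale tau_cscale tau_complex_def
      i field_simps power3_eq_cube split: prod.splits)
  show "pscale \<theta> (pcross P Q R) = pcross (pscale \<theta> P) (pscale \<theta> Q) (pscale \<theta> R)" for P Q R
  proof -
    obtain X Y \<xi> \<eta> where P: "P = (X, Y, \<xi>, \<eta>)" by (metis surj_pair)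
    obtain Z W \<zeta> \<omega> where Q: "Q = (Z, W, \<zeta>, \<omega>)" by (metis surj_pair)
    obtain U V \<kappa> \<mu> where R: "R = (U, V, \<kappa>, \<mu>)" by (metis surj_pair)
    define A where "A = (1 / 4) *\<^sub>C (\<xi> *\<^sub>C Z + \<zeta> *\<^sub>C X) - (1 / 2) *\<^sub>C jcross Y W"
    define B where "B = (1 / 2) *\<^sub>C jcross X Z - (1 / 4) *\<^sub>C (\<eta> *\<^sub>C W + \<omega> *\<^sub>C Y)"
    \<comment> \<open>The coordinates have weights -1, 1, 3, -3, which gives A weight 2 and B weight
      -2. For instance, \<mu>A has weight 2 - 3 = -1, as the first coordinate requires.\<close>
    have A: "(1 / 4) *\<^sub>C ((\<theta> ^ 3 * \<xi>) *\<^sub>C inverse \<theta> *\<^sub>C Z + (\<theta> ^ 3 * \<zeta>) *\<^sub>C inverse \<theta> *\<^sub>C X)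
        - (1 / 2) *\<^sub>C jcross (\<theta> *\<^sub>C Y) (\<theta> *\<^sub>C W) = \<theta>\<^sup>2 *\<^sub>C A"
      and B: "(1 / 2) *\<^sub>C jcross (inverse \<theta> *\<^sub>C X) (inverse \<theta> *\<^sub>C Z)
        - (1 / 4) *\<^sub>C ((inverse \<theta> ^ 3 * \<eta>) *\<^sub>C \<theta> *\<^sub>C W + (inverse \<theta> ^ 3 * \<omega>) *\<^sub>C \<theta> *\<^sub>C Y) =
          inverse \<theta> ^ 2 *\<^sub>C B"
      using n by (simp_all add: A_def B_def jcross_cscale cscale_add_right
        cscale.scale_right_diff_distrib cscale_cscale
         power3_eq_cube power2_eq_square field_simps)
    have v: "jvee (c *\<^sub>C X) (d *\<^sub>C W) (e *\<^sub>C U) = (c * d * e) *\<^sub>C jvee X W U" for c d e X W U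
      by (simp add: jvee_def jinner_cscale jcross_cscale scaleR_cscale cscale.scale_right_diff_distrib
        cscale_add_right cscale_cscale mult_ac)
    have j: "jinner (inverse \<theta> *\<^sub>C X) (\<theta> *\<^sub>C W) = jinner X W" for X W
      using n by (simp add: jinner_cscale)
    have x: "inverse \<theta> ^ 3 * \<eta> * (\<theta> ^ 3 * \<xi>) = \<eta> * \<xi>" "\<theta> ^ 3 * \<xi> * (inverse \<theta> ^ 3 * \<eta>) = \<xi> * \<eta>" for \<xi> \<eta>
      using n by (simp_all add: field_simps)
    show ?thesis
      unfolding P Q R pscale_def prod.case pcross_coords Let_def A B A_def[symmetric]
        B_def[symmetric] v j x
      using n by (simp add: jinner_cscale jcross_cscale cscale_cscale cscale_add_right
         cscale.scale_right_diff_distrib power3_eq_cube power2_eq_square algebra_simps)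
  qed
qed

section \<open>The one-parameter group \<open>\<phi>\<^sub>1\<close> and elements of rank one\<close>

text \<open>
  Otherwise the simplifier splits every quantifier over \<open>JC\<close> or \<open>PC\<close> into 27 or 56 complex ones.
\<close>

declare split_paired_All [simp del] split_paired_Ex [simp del]

section \<open>Unit complex numbers and the circle \<open>phi1\<close>\<close>

lemma tau_mult_self_eq_1_iff: "tau \<theta> * \<theta> = 1 \<longleftrightarrow> cmod \<theta> = 1" for \<theta> :: complex
proof -
  have "tau \<theta> * \<theta> = of_real ((cmod \<theta>)\<^sup>2)"
    by (metis complex_norm_square mult.commute tau_complex_def)
  then show ?thesis
    by (metis abs_norm_cancel abs_square_eq_1 of_real_eq_1_iff)
qed

lemma cnj_unit: "cmod \<theta> = 1 \<Longrightarrow> cnj \<theta> = inverse \<theta>"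
  by (metis tau_mult_self_eq_1_iff inverse_unique mult.commute tau_complex_def)

lemma unit_root:
  assumes "cmod \<mu> = 1" "0 < n"
  shows "\<exists>\<theta>. cmod \<theta> = 1 \<and> \<theta> ^ n = \<mu>"
proof (intro exI conjI)
  have "\<mu> \<noteq> 0" using assms by auto
  then show "cis (Arg \<mu> / n) ^ n = \<mu>"
    using assms by (simp only: Complex.DeMoivre) (simp add: cis_Arg sgn_div_norm)
qed simp

lemma phi1_clinear: "clinear (phi1 \<theta>)"
  by (auto simp: clinear_def phi1_def cscale_add_right cscale_cscale cscale_complex_def algebra_simps)

lemma cstar_phi1: "cmod \<theta> = 1 \<Longrightarrow> cstar (phi1 \<theta>) = phi1 (inverse \<theta>)"
proof (rule ext)
  fix X assume "cmod \<theta> = 1"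
  then show "cstar (phi1 \<theta>) X = phi1 (inverse \<theta>) X"
    by (cases X rule: jordan_cases) (simp add: cstar_def phi1_def tau_cscale tau_tau
      tau_complex_def cnj_unit)
qed

text \<open>The weights 4, -2, 1 add up to zero on every monomial of the determinant, so each
  coordinate of the cross product has the opposite of its usual weight.\<close>

lemma phi1_E6:
  assumes "cmod \<theta> = 1"
  shows "phi1 \<theta> \<in> E6"
proof (rule E6I)
  have n: "\<theta> \<noteq> 0" using assms by auto
  note s = cstar_phi1[OF assms]
  show "clinear (phi1 \<theta>)" by (rule phi1_clinear)
  show "jinner (phi1 \<theta> X) (cstar (phi1 \<theta>) Y) = jinner X Y" for X Y
    using n unfolding s
    by (cases X rule: jordan_cases; cases Y rule: jordan_cases)
       (simp add: phi1_def jinner_odot odot_cscale power_inverse field_simps)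
  show "jcross (phi1 \<theta> X) (phi1 \<theta> Y) = cstar (phi1 \<theta>) (jcross X Y)" for X Y
    using n unfolding s
    apply (cases X rule: jordan_cases; cases Y rule: jordan_cases)
    apply (simp add: phi1_def jcross_coords odot_cscale omul_cscale oconj_cscale oconj_add
      cscale_add_right
         cscale.scale_right_diff_distrib cscale_cscale cscale_complex_def)
    apply (simp add: field_simps power4_eq_xxxx power2_eq_square)
    done
qed

lemma phi1_mult: "phi1 (s * t) X = phi1 s (phi1 t X)"
  by (cases X rule: jordan_cases) (simp add: phi1_def cscale_cscale power_mult_distrib)

lemma phi1_1: "phi1 1 = id"
  by (auto simp: phi1_def fun_eq_iff)

lemma sigma6_phi1: "sigma6 = phi1 (- 1)"
  by (auto simp: phi1_def sigma6_def fun_eq_iff)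

lemma phi1_jE1: "phi1 s jE1 = s ^ 4 *\<^sub>C jE1"
  by (simp add: phi1_def jE1_def cscale_complex_def)

text \<open>The weights 4, -2 and 1 agree modulo 3, so \<open>phi1\<close> acts as a scalar here.
  This is the source of the factor \<open>Z3\<close>.\<close>

lemma phi1_cube_root:
  assumes "\<theta> ^ 3 = 1"
  shows "phi1 \<theta> X = \<theta> *\<^sub>C X"
proof -
  have "\<theta> \<noteq> 0" using assms by auto
  then have "\<theta> ^ 4 = \<theta>" "inverse (\<theta>\<^sup>2) = \<theta>"
    using assms by (simp_all add: field_simps power2_eq_square power3_eq_cube power4_eq_xxxx)
  then show ?thesis
    by (cases X rule: jordan_cases) (simp add: phi1_def cscale_complex_def)
qed

section \<open>The vector \<open>jE1\<close> and its stabilizer in E6\<close>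

lemma jordan_eq_0: "(a, b, c, x, y, z) = (0 :: JC) \<longleftrightarrow> a = 0 \<and> b = 0 \<and> c = 0 \<and> x = 0 \<and> y = 0 \<and> z = 0"
  by (simp add: prod_eq_iff)

lemma jcross_jE1: "jcross jE1 (a, b, c, x, y, z) = (1 / 2) *\<^sub>C (0, c, b, - x, 0, 0)"
  by (simp add: jE1_def jcross_coords cscale_complex_def)

lemma half_cscale_eq_0: "(1 / 2) *\<^sub>C x = 0 \<longleftrightarrow> x = (0::'a::cspace)"
  by (simp add: cscale.scale_eq_0_iff)

lemma tau_jE1: "tau jE1 = jE1"
  by (simp add: jE1_def tau_complex_def)

lemma jherm_jE1: "jherm jE1 (a, b, c, x, y, z) = a"
  unfolding jherm_def tau_jE1 by (simp add: jE1_def jinner_odot)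

text \<open>The weight spaces of \<open>phi1\<close>, of dimensions 1, 10 and 16, can be described
  by \<open>jE1\<close>, the cross product and the hermitian form alone. So \<delta> preserves each
  of them.\<close>

lemma E6_fix_E1_commute:
  assumes \<delta>: "\<delta> \<in> E6" and f: "\<delta> jE1 = jE1"
  shows "\<delta> (phi1 s X) = phi1 s (\<delta> X)"
proof -
  note l = E6_clinear[OF \<delta>]
  have fs: "cstar \<delta> jE1 = jE1"
    by (simp add: cstar_def tau_jE1 f)
  \<comment> \<open>The 16-dimensional space consists of the vectors orthogonal to
    \<open>jE1\<close> and annihilated by \<open>jcross jE1\<close>.\<close>
  have 16: "\<exists>y' z'. \<delta> (0, 0, 0, 0, y, z) = (0, 0, 0, 0, y', z')" for y z
  proof -
    obtain a b c x y' z' where d: "\<delta> (0, 0, 0, 0, y, z) = (a, b, c, x, y', z')"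
      by (rule jordan_cases)
    have "jcross jE1 (0, 0, 0, 0, y, z) = 0"
      by (simp add: jcross_jE1 jordan_eq_0)
    then have "jcross jE1 (a, b, c, x, y', z') = 0"
      using E6_jcross[OF \<delta>, of jE1 "(0, 0, 0, 0, y, z)"] clinear_0[OF clinear_cstar[OF l]]
      by (simp add: f d)
    moreover have "a = 0"
      using E6_jherm[OF \<delta>, of jE1 "(0, 0, 0, 0, y, z)"] by (simp add: f d jherm_jE1)
    ultimately have "(0, c, b, - x, 0, 0) = (0 :: JC)" "a = 0"
      unfolding jcross_jE1 half_cscale_eq_0 by blast+
    then show ?thesis
      unfolding d by (simp add: jordan_eq_0)
  qed
  \<comment> \<open>The 10-dimensional space is the image of \<open>jcross jE1\<close>, and
    \<open>cstar \<delta>\<close> fixes \<open>jE1\<close> too.\<close>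
  have 10: "\<exists>b' c' x'. \<delta> (0, b, c, x, 0, 0) = (0, b', c', x', 0, 0)" for b c x
  proof -
    have "(0, b, c, x, 0, 0) = jcross jE1 (0, 2 * c, 2 * b, (- 2) *\<^sub>C x, 0, 0)"
      by (simp add: jcross_jE1 cscale_cscale cscale_complex_def)
    moreover have "\<exists>b c x. jcross jE1 X = (0, b, c, x, 0, 0)" for X
      by (cases X rule: jordan_cases) (simp only: jcross_jE1 cscale_Pair cscale.scale_zero_right, blast)
    ultimately show ?thesis
      by (metis cstar_jcross[OF \<delta>] fs)
  qed
  obtain a b c x y z where X: "X = (a, b, c, x, y, z)"
    by (rule jordan_cases)
  obtain y' z' where d1: "\<delta> (0, 0, 0, 0, y, z) = (0, 0, 0, 0, y', z')" using 16 by blast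
  obtain b' c' x' where d2: "\<delta> (0, b, c, x, 0, 0) = (0, b', c', x', 0, 0)" using 10 by blast
  have X': "X = a *\<^sub>C jE1 + (0, b, c, x, 0, 0) + (0, 0, 0, 0, y, z)"
    by (simp add: X jE1_def cscale_complex_def)
  have p: "phi1 s X = (s ^ 4 * a) *\<^sub>C jE1 + inverse (s\<^sup>2) *\<^sub>C (0, b, c, x, 0, 0) + s *\<^sub>C (0, 0, 0,
    0, y, z)"
    by (simp add: X phi1_def jE1_def cscale_complex_def)
  have "\<delta> X = (a, b', c', x', y', z')"
    unfolding X' clinear_add[OF l] clinear_cscale[OF l] f d1 d2
    by (simp add: jE1_def cscale_complex_def)
  moreover have "\<delta> (phi1 s X) = phi1 s (a, b', c', x', y', z')"
    unfolding p clinear_add[OF l] clinear_cscale[OF l] f d1 d2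
    by (simp add: jE1_def cscale_complex_def phi1_def)
  ultimately show ?thesis by simp
qed

text \<open>The hypothesis would place the solutions of one linear equation in a 10-dimensional
  space inside the line spanned by \<open>(m2, m3, m)\<close>. Explicit solutions refute it.\<close>

lemma hyperplane_not_line:
  assumes "\<And>b c x. m2 * c + m3 * b - 2 * odot m x = 0 \<Longrightarrow> \<exists>k. b = k * m2 \<and> c = k * m3 \<and> x = k *\<^sub>C m"
  shows False
proof -
  define e :: "complex oct" where "e = (((1, 0), (0, 0)), ((0, 0), (0, 0)))"
  have e: "e \<noteq> 0" by (simp add: e_def zero_prod_def)
  consider "m2 \<noteq> 0" "m3 \<noteq> 0" | "m2 = 0" | "m3 = 0" by blast
  then show False
  proof cases
    case 1
    from assms[of "- m3" m2 0] 1 obtain k where k: "m2 = k * m2" "- m3 = k * m3"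
      using assms[of "m2" "- m3" 0] by auto
    then have "k = 1" using 1 by simp
    then show False using k 1 by simp
  next
    \<comment> \<open>As \<open>m2\<close> vanishes, \<open>(0, 1, 0)\<close> is a solution. Lying
      in the line, it forces \<open>m = 0\<close>, and then \<open>(0, 0, e)\<close> is a solution
      outside the line.\<close>
    case 2
    then obtain k where "1 = k * m3" "0 = k *\<^sub>C m"
      using assms[of 1 0 0] assms[of 0 1 0] by auto
    then have m: "m = 0" "m3 \<noteq> 0"
      by auto
    then show False
      using assms[of 0 0 e] e by auto
  next
    case 3
    then obtain k where "1 = k * m2" "0 = k *\<^sub>C m"
      using assms[of 1 0 0] assms[of 0 1 0] by auto
    then have m: "m = 0" "m2 \<noteq> 0"
      by auto
    then show False
      using assms[of 0 0 e] e by auto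
  qed
qed

lemma minus_eq_self: "- x = x \<longleftrightarrow> x = 0" for x :: "'a::real_vector"
proof
  assume "- x = x"
  then have "x + x = 0"
    by (metis add.right_inverse)
  then show "x = 0"
    by (simp flip: scaleR_2)
qed simp

lemma sigma6_fixed_iff: "sigma6 X = X \<longleftrightarrow> (\<exists>a b c x. X = (a, b, c, x, 0, 0))"
proof -
  show ?thesis
    by (cases X rule: jordan_cases) (simp add: sigma6_def minus_eq_self)
qed

text \<open>Among the vectors fixed by \<open>sigma6\<close>, the multiples of \<open>jE1\<close>
  are singled out by a small annihilator, a property that linear symmetries transport. If the first
  coordinate of \<open>M\<close> vanished, the annihilator would contain the solutions of a linear
  equation in ten variables. Otherwise \<open>jcross M M = 0\<close> kills the other
  coordinates.\<close>

lemma rank_one_sigma6: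
  assumes M: "sigma6 M = M" "jcross M M = 0"
    and line: "\<And>Z. sigma6 Z = Z \<Longrightarrow> jcross M Z = 0 \<Longrightarrow> \<exists>k. Z = k *\<^sub>C M"
  shows "\<exists>m. M = m *\<^sub>C jE1"
proof -
  obtain a b c x where M': "M = (a, b, c, x, 0, 0)"
    using M(1) by (auto simp: sigma6_fixed_iff)
  have "a \<noteq> 0"
  proof
    assume a: "a = 0"
    show False
    proof (rule hyperplane_not_line)
      fix b' c' x' assume "b * c' + c * b' - 2 * odot x x' = 0"
      then have "jcross M (0, b', c', x', 0, 0) = 0"
        by (simp add: M' a jcross_coords jordan_eq_0 cscale_complex_def)
      then obtain k where "(0, b', c', x', 0, 0) = k *\<^sub>C M"
        using line[of "(0, b', c', x', 0, 0)"] by (auto simp: sigma6_fixed_iff)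
      then show "\<exists>k. b' = k * b \<and> c' = k * c \<and> x' = k *\<^sub>C x"
        by (auto simp: M' cscale_complex_def)
    qed
  qed
  moreover have "a * c = 0 \<and> a * b = 0 \<and> a *\<^sub>C x = 0"
    using M(2) unfolding M' jcross_coords half_cscale_eq_0
    using minus_eq_self[of "a *\<^sub>C x"] by (simp add: jordan_eq_0 mult.commute)
  ultimately have "M = a *\<^sub>C jE1"
    by (simp add: M' jE1_def cscale_complex_def)
  then show ?thesis ..
qed

section \<open>The centralizer of \<open>\<sigma>\<close> and \<open>\<iota>\<close>\<close>

lemma PC_cases:
  obtains X Y \<xi> \<eta> where "(P :: PC) = (X, Y, \<xi>, \<eta>)"
  by (metis surj_pair)

lemma E7_fixed_iff:
  assumes "bij \<gamma>"
  shows "\<alpha> \<in> E7_fixed \<gamma> \<longleftrightarrow> \<alpha> \<in> E7 \<and> (\<forall>P. \<alpha> (\<gamma> P) = \<gamma> (\<alpha> P))"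
proof -
  have "\<gamma> \<circ> \<alpha> \<circ> inv_into UNIV \<gamma> = \<alpha> \<longleftrightarrow> (\<forall>P. \<alpha> (\<gamma> P) = \<gamma> (\<alpha> P))"
  proof
    assume *: "\<gamma> \<circ> \<alpha> \<circ> inv_into UNIV \<gamma> = \<alpha>"
    show "\<forall>P. \<alpha> (\<gamma> P) = \<gamma> (\<alpha> P)"
      using fun_cong[OF *, of "\<gamma> _"] assms by (simp add: bij_is_inj)
  next
    assume *: "\<forall>P. \<alpha> (\<gamma> P) = \<gamma> (\<alpha> P)"
    show "\<gamma> \<circ> \<alpha> \<circ> inv_into UNIV \<gamma> = \<alpha>"
      by (rule ext) (simp only: o_apply *[rule_format, symmetric] surj_f_inv_f[OF bij_is_surj[OF
        assms]])
  qed
  then show ?thesis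
    by (simp add: E7_fixed_def)
qed

lemma bij_neg_sigma7: "bij neg_sigma7"
proof (rule o_bij)
  have "neg_sigma7 (neg_sigma7 P) = P" for P
    by (cases P rule: PC_cases; cases "fst P" rule: jordan_cases; cases "fst (snd P)" rule:
      jordan_cases)
      (simp add: neg_sigma7_def sigma7_def sigma6_def)
  then show "neg_sigma7 \<circ> neg_sigma7 = id" "neg_sigma7 \<circ> neg_sigma7 = id"
    by (simp_all add: fun_eq_iff)
qed

lemma bij_iota7: "bij iota7"
proof (rule o_bij)
  have "iota7 (- iota7 P) = P" "- iota7 (iota7 P) = P" for P
    by (cases P rule: PC_cases; simp add: iota7_def cscale_cscale)+
  then show "iota7 \<circ> (\<lambda>P. - iota7 P) = id" "(\<lambda>P. - iota7 P) \<circ> iota7 = id"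
    by (simp_all add: fun_eq_iff)
qed

text \<open>Linearity absorbs the sign of \<open>neg_sigma7\<close>.\<close>

lemma centralizer_iff:
  "\<alpha> \<in> E7_fixed neg_sigma7 \<inter> E7_fixed iota7 \<longleftrightarrow>
    \<alpha> \<in> E7 \<and> (\<forall>P. \<alpha> (sigma7 P) = sigma7 (\<alpha> P)) \<and> (\<forall>P. \<alpha> (iota7 P) = iota7 (\<alpha> P))"
proof -
  have "\<alpha> (neg_sigma7 P) = neg_sigma7 (\<alpha> P) \<longleftrightarrow> \<alpha> (sigma7 P) = sigma7 (\<alpha> P)" if "\<alpha> \<in> E7" for P
    using linear_neg[OF clinear_linear[OF E7_clinear[OF that]]] by (simp add: neg_sigma7_def)
  then show ?thesis
    by (auto simp: E7_fixed_iff[OF bij_neg_sigma7] E7_fixed_iff[OF bij_iota7])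
qed

text \<open>A linear map that commutes with \<open>iota7\<close> preserves these two
  eigenspaces.\<close>

lemma iota7_eigen:
  "iota7 P = (- \<i>) *\<^sub>C P \<longleftrightarrow> (\<exists>X \<xi>. P = (X, 0, \<xi>, 0))"
  "iota7 P = \<i> *\<^sub>C P \<longleftrightarrow> (\<exists>Y \<eta>. P = (0, Y, 0, \<eta>))"
proof -
  have i: "\<i> \<noteq> - \<i>"
    by (simp add: complex_eq_iff)
  obtain X Y \<xi> \<eta> where P: "P = (X, Y, \<xi>, \<eta>)"
    by (rule PC_cases)
  show "iota7 P = (- \<i>) *\<^sub>C P \<longleftrightarrow> (\<exists>X \<xi>. P = (X, 0, \<xi>, 0))"
    unfolding P iota7_def prod.case cscale_Pair prod.inject cscale.scale_cancel_right
    using i by (auto simp: cscale_complex_def simp del: cscale.scale_minus_left)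
  show "iota7 P = \<i> *\<^sub>C P \<longleftrightarrow> (\<exists>Y \<eta>. P = (0, Y, 0, \<eta>))"
    unfolding P iota7_def prod.case cscale_Pair prod.inject cscale.scale_cancel_right
    using i by (auto simp: cscale_complex_def simp del: cscale.scale_minus_left)
qed

lemma jvee_0: "jvee X 0 U = 0" "jvee 0 X U = 0"
  using jcross_cscale(1)[of 0 0] jinner_cscale(1)[of 0 0] jcross_cscale(2)[of _ 0 0]
    jinner_cscale(2)[of _ 0 0]
  by (simp_all add: jvee_def scaleR_cscale)

lemma jcross_0 [simp]: "jcross 0 X = 0" "jcross X 0 = 0"
  using jcross_cscale(1)[of 0 0] jcross_cscale(2)[of _ 0 0] by simp_all

lemma jinner_0 [simp]: "jinner 0 X = 0" "jinner X 0 = 0"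
  using jinner_cscale(1)[of 0 0] jinner_cscale(2)[of _ 0 0] by simp_all

lemma jherm_0 [simp]: "jherm 0 X = 0" "jherm X 0 = 0"
  by (simp_all add: jherm_def)

lemma jherm_eq_0: "jherm X X = 0 \<Longrightarrow> X = 0"
  using norm_le_jherm[of X] by simp

text \<open>Products of special vectors, evaluated at \<open>(0, 0, 1, 0)\<close>, isolate the
  pairing and the cross product. The first makes \<open>B\<close> contragredient to
  \<open>A\<close>; the second makes the pair compatible with cross products.\<close>

lemma E7_diagonal:
  assumes \<gamma>: "\<gamma> \<in> E7" and d: "\<And>X Y \<xi> \<eta>. \<gamma> (X, Y, \<xi>, \<eta>) = (A X, B Y, \<xi>, \<eta>)"
  shows "A \<in> E6 \<and> \<gamma> = jlift A"
proof -
  have l: "clinear A"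
    using clinear_add[OF E7_clinear[OF \<gamma>], of "(_, 0, 0, 0)" "(_, 0, 0, 0)"]
      clinear_cscale[OF E7_clinear[OF \<gamma>], of _ "(_, 0, 0, 0)"]
    by (simp add: clinear_def d)
  have 0: "A 0 = 0" "B 0 = 0"
    using d[of 0 0 0 0] clinear_0[OF E7_clinear[OF \<gamma>]] by (simp_all add: zero_prod_def)
  have h: "jherm (A X) (A Y) = jherm X Y" for X Y
    using E7_pherm[OF \<gamma>, of "(X, 0, 0, 0)" "(Y, 0, 0, 0)"] by (simp add: d pherm_def 0)
  have b: "bij A"
    by (rule bij_of_jherm[OF l h])
  \<comment> \<open>Only the third coordinate of the value survives; it is \<open>jinner X W\<close>
    divided by 8.\<close>
  have AB: "jinner (A X) (B W) = jinner X W" for X W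
    using E7_pcross[OF \<gamma>, of "(X, 0, 0, 0)" "(0, W, 0, 0)" "(0, 0, 1, 0)"]
    by (simp add: d pcross_coords 0 Let_def)
  have "jinner (A X) (cstar A W) = jinner X W" for X W
    using h[of "tau W" X] by (simp add: jherm_def cstar_def tau_tau jinner_commute)
  then have "jinner (A X) (B W) = jinner (A X) (cstar A W)" for X W
    by (simp add: AB)
  then have B: "B W = cstar A W" for W
    using b by (intro jinner_nondegenerate) (metis bij_pointE)
  have Bl: "clinear B"
    using clinear_cstar[OF l] by (simp add: clinear_def B)
  \<comment> \<open>Here only the second coordinate survives; it is half of
    \<open>jcross X Y\<close>.\<close>
  have "jcross (A X) (A Y) = B (jcross X Y)" for X Y
    using E7_pcross[OF \<gamma>, of "(X, 0, 0, 0)" "(Y, 0, 0, 0)" "(0, 0, 1, 0)"]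
    by (simp add: d pcross_coords 0 jvee_0 clinear_cscale[OF Bl] Let_def)
  then have "A \<in> E6"
    using l AB by (intro E6I) (simp_all add: B)
  moreover have "\<gamma> = jlift A"
  proof
    show "\<gamma> P = jlift A P" for P
      by (cases P rule: PC_cases) (simp add: d jlift_def B)
  qed
  ultimately show ?thesis by blast
qed

lemma pscale_mult: "pscale (s * t) P = pscale s (pscale t P)"
  by (cases P rule: PC_cases) (simp add: pscale_def cscale_cscale power_mult_distrib)

lemma pscale_1: "pscale 1 P = P"
  by (cases P rule: PC_cases) (simp add: pscale_def)

lemma PC_eq_0: "(X, Y, \<xi>, \<eta>) = (0 :: PC) \<longleftrightarrow> X = 0 \<and> Y = 0 \<and> \<xi> = 0 \<and> \<eta> = 0"
  by (simp add: prod_eq_iff)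

text \<open>Within this eigenspace the parameters \<phi> and \<nu> of the product vanish. Evaluation
  at the two unit scalar vectors reads off B and A.\<close>

lemma pcross_line:
  "(\<forall>R. pcross (X, 0, \<xi>, 0) (Z, 0, \<zeta>, 0) R = 0) \<longleftrightarrow> \<xi> *\<^sub>C Z + \<zeta> *\<^sub>C X = 0 \<and> jcross X Z = 0"
proof
  assume *: "\<forall>R. pcross (X, 0, \<xi>, 0) (Z, 0, \<zeta>, 0) R = 0"
  show "\<xi> *\<^sub>C Z + \<zeta> *\<^sub>C X = 0 \<and> jcross X Z = 0"
    using *[rule_format, of "(0, 0, 1, 0)"] *[rule_format, of "(0, 0, 0, 1)"]
    by (simp add: pcross_coords jvee_0 PC_eq_0)
next
  assume *: "\<xi> *\<^sub>C Z + \<zeta> *\<^sub>C X = 0 \<and> jcross X Z = 0"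
  show "\<forall>R. pcross (X, 0, \<xi>, 0) (Z, 0, \<zeta>, 0) R = 0"
  proof
    fix R :: PC
    show "pcross (X, 0, \<xi>, 0) (Z, 0, \<zeta>, 0) R = 0"
      by (cases R rule: PC_cases) (simp add: * pcross_coords jvee_0 PC_eq_0)
  qed
qed

lemma centralizer_pole:
  assumes \<alpha>: "\<alpha> \<in> E7" and s: "\<And>P. \<alpha> (sigma7 P) = sigma7 (\<alpha> P)"
    and i: "\<And>P. \<alpha> (iota7 P) = iota7 (\<alpha> P)"
  shows "\<exists>\<mu>. \<alpha> (0, 0, 1, 0) = (0, 0, \<mu>, 0)"
proof -
  note l = E7_clinear[OF \<alpha>]
  have inj: "\<alpha> P = \<alpha> Q \<longleftrightarrow> P = Q" for P Q
    using E7_bij[OF \<alpha>] by (simp add: bij_is_inj inj_eq)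
  have V': "(\<exists>X \<xi>. \<alpha> P = (X, 0, \<xi>, 0)) \<longleftrightarrow> (\<exists>X \<xi>. P = (X, 0, \<xi>, 0))" for P
    unfolding iota7_eigen[symmetric] by (simp only: i[symmetric] clinear_cscale[OF l, symmetric] inj)
  obtain M \<mu> where M: "\<alpha> (0, 0, 1, 0) = (M, 0, \<mu>, 0)"
    using V' by blast
  have z: "pcross (\<alpha> P) (\<alpha> Q) R = 0" if "\<And>R. pcross P Q R = 0" for P Q R
  proof -
    obtain R' where "R = \<alpha> R'" by (rule surjE[OF bij_is_surj[OF E7_bij[OF \<alpha>]]])
    then show ?thesis
      using that[of R'] by (simp add: clinear_0[OF l] flip: E7_pcross[OF \<alpha>])
  qed
  have "(\<forall>R. pcross (M, 0, \<mu>, 0) (M, 0, \<mu>, 0) R = 0)"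
    using z[of "(0, 0, 1, 0)" "(0, 0, 1, 0)"] pcross_line[of 0 1 0 1] by (simp add: M)
  then have MM: "\<mu> *\<^sub>C M + \<mu> *\<^sub>C M = 0" "jcross M M = 0"
    unfolding pcross_line by blast+
  have sM: "sigma6 M = M"
    using s[of "(0, 0, 1, 0)"] by (simp add: M sigma7_def sigma6_phi1 clinear_0[OF phi1_clinear])
  have "M = 0"
  proof (rule ccontr)
    assume M0: "M \<noteq> 0"
    have "(2 * \<mu>) *\<^sub>C M = 0"
      using MM(1) by (simp only: mult_2 cscale_add_left)
    then have \<mu>: "\<mu> = 0"
      using M0 by simp
    \<comment> \<open>The annihilator of \<open>(0, 0, 1, 0)\<close> in its eigenspace is a line;
      \<alpha> carries this to \<open>(M, 0, 0, 0)\<close>.\<close>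
    have line: "\<exists>k. Z = k *\<^sub>C M" if "jcross M Z = 0" for Z
    proof -
      obtain Q where Q: "(Z, 0, 0, 0) = \<alpha> Q"
        by (rule surjE[OF bij_is_surj[OF E7_bij[OF \<alpha>]]])
      then have "\<exists>X \<xi>. \<alpha> Q = (X, 0, \<xi>, 0)"
        by (simp flip: Q)
      then obtain X \<xi> where Q': "Q = (X, 0, \<xi>, 0)"
        unfolding V' by blast
      have "pcross (M, 0, \<mu>, 0) (Z, 0, 0, 0) R = 0" for R
        using that \<mu> pcross_line[of M \<mu> Z 0] by simp
      then have "\<alpha> (pcross (0, 0, 1, 0) Q R) = 0" for R
        unfolding E7_pcross[OF \<alpha>] M Q[symmetric] by blast
      then have "pcross (0, 0, 1, 0) (X, 0, \<xi>, 0) R = 0" for R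
        using inj[of _ 0] clinear_0[OF l] by (simp add: Q')
      then have "X = 0"
        using pcross_line[of 0 1 X \<xi>] by simp
      then have "Q = \<xi> *\<^sub>C (0, 0, 1, 0)"
        by (simp add: Q' cscale_complex_def)
      then have "\<alpha> Q = \<xi> *\<^sub>C (M, 0, \<mu>, 0)"
        by (simp only: clinear_cscale[OF l] M)
      from trans[OF Q this] have "(Z, 0, 0, 0) = \<xi> *\<^sub>C (M, 0 :: JC, \<mu>, 0 :: complex)" .
      then show ?thesis by auto
    qed
    obtain m where m: "M = m *\<^sub>C jE1"
      using rank_one_sigma6[OF sM MM(2)] line by blast
    \<comment> \<open>The line property holds for all \<open>Z\<close>, not only for those fixed by
      \<open>sigma6\<close>. A vector in the 16-dimensional space annihilated by \<open>jE1\<close>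
      contradicts it.\<close>
    define e :: "complex oct" where "e = (((1, 0), (0, 0)), ((0, 0), (0, 0)))"
    have e: "e \<noteq> 0" by (simp add: e_def zero_prod_def)
    have "jcross M (0, 0, 0, 0, e, 0) = 0"
      by (simp add: m jcross_cscale jcross_jE1 jordan_eq_0)
    then obtain k where "(0, 0, 0, 0, e, 0) = k *\<^sub>C M"
      using line by blast
    then show False
      using e by (simp add: m jE1_def)
  qed
  then show ?thesis
    using M by blast
qed

lemma cmod_eq_1_iff_cnj: "cmod \<mu> = 1 \<longleftrightarrow> cnj \<mu> * \<mu> = 1"
  using tau_mult_self_eq_1_iff[of \<mu>] by (simp add: tau_complex_def)

lemma centralizer_form:
  assumes \<alpha>: "\<alpha> \<in> E7" and s: "\<And>P. \<alpha> (sigma7 P) = sigma7 (\<alpha> P)"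
    and i: "\<And>P. \<alpha> (iota7 P) = iota7 (\<alpha> P)"
  shows "\<exists>\<mu> A B. cmod \<mu> = 1 \<and> (\<forall>X Y \<xi> \<eta>. \<alpha> (X, Y, \<xi>, \<eta>) = (A X, B Y, \<mu> * \<xi>, inverse \<mu> * \<eta>))"
proof -
  note l = E7_clinear[OF \<alpha>]
  note h = E7_pherm[OF \<alpha>]
  obtain \<mu> where \<mu>: "\<alpha> (0, 0, 1, 0) = (0, 0, \<mu>, 0)"
    using centralizer_pole[OF assms] by blast
  have u: "cmod \<mu> = 1"
    using h[of "(0, 0, 1, 0)" "(0, 0, 1, 0)"] unfolding cmod_eq_1_iff_cnj
    by (simp add: \<mu> pherm_def tau_complex_def)
  then have \<mu>0: "\<mu> \<noteq> 0" by auto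
  have V1: "\<exists>X' \<xi>'. \<alpha> (X, 0, \<xi>, 0) = (X', 0, \<xi>', 0)" for X \<xi>
  proof -
    have "iota7 (X, 0, \<xi>, 0) = (- \<i>) *\<^sub>C (X, 0, \<xi>, 0)"
      unfolding iota7_eigen by blast
    then show ?thesis
      unfolding iota7_eigen[symmetric] by (simp only: i[symmetric] clinear_cscale[OF l, symmetric])
  qed
  have V2: "\<exists>Y' \<eta>'. \<alpha> (0, Y, 0, \<eta>) = (0, Y', 0, \<eta>')" for Y \<eta>
  proof -
    have "iota7 (0, Y, 0, \<eta>) = \<i> *\<^sub>C (0, Y, 0, \<eta>)"
      unfolding iota7_eigen by blast
    then show ?thesis
      unfolding iota7_eigen[symmetric] by (simp only: i[symmetric] clinear_cscale[OF l, symmetric])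
  qed
  obtain N \<nu> where N: "\<alpha> (0, 0, 0, 1) = (0, N, 0, \<nu>)"
    using V2 by blast
  \<comment> \<open>The product of the two unit scalar vectors has \<nu>-parameter -3/8. Comparing
    third coordinates after applying \<alpha> gives \<mu>\<nu> = 1.\<close>
  have "pcross (0, 0, 1, 0) (0, 0, 0, 1) (0, 0, 1, 0) = (- (3 / 8)) *\<^sub>C (0, 0, 1, 0)"
    by (simp add: pcross_coords jvee_0 cscale_complex_def)
  then have "pcross (0, 0, \<mu>, 0) (0, N, 0, \<nu>) (0, 0, \<mu>, 0) = (- (3 / 8)) *\<^sub>C (0, 0, \<mu>, 0)"
    using E7_pcross[OF \<alpha>, of "(0, 0, 1, 0)" "(0, 0, 0, 1)" "(0, 0, 1, 0)"]
    by (simp only: \<mu> N clinear_cscale[OF l])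
  then have \<nu>: "\<nu> = inverse \<mu>"
    using \<mu>0 by (simp add: pcross_coords jvee_0 cscale_complex_def Let_def field_simps)
  \<comment> \<open>The image has norm one and its scalar part already has modulus one, which leaves
    nothing for \<open>N\<close>.\<close>
  have "jherm N N + cnj \<nu> * \<nu> = 1"
    using h[of "(0, 0, 0, 1)" "(0, 0, 0, 1)"] by (simp add: N pherm_def tau_complex_def)
  moreover have "cnj \<nu> * \<nu> = 1"
    using u unfolding \<nu> cmod_eq_1_iff_cnj[symmetric] by (simp add: norm_inverse)
  ultimately have N0: "N = 0"
    by (intro jherm_eq_0) simp
  \<comment> \<open>Orthogonality to the image of \<open>(0, 0, 1, 0)\<close> removes the scalar
    component.\<close>
  have "\<exists>X'. \<alpha> (X, 0, 0, 0) = (X', 0, 0, 0)" for X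
    using V1[of X 0] h[of "(0, 0, 1, 0)" "(X, 0, 0, 0)"] \<mu>0 by (auto simp: \<mu> pherm_def tau_complex_def)
  then obtain A where A: "\<And>X. \<alpha> (X, 0, 0, 0) = (A X, 0, 0, 0)"
    by metis
  have "\<exists>Y'. \<alpha> (0, Y, 0, 0) = (0, Y', 0, 0)" for Y
    using V2[of Y 0] h[of "(0, 0, 0, 1)" "(0, Y, 0, 0)"] \<mu>0 by (auto simp: N N0 \<nu> pherm_def
      tau_complex_def)
  then obtain B where B: "\<And>Y. \<alpha> (0, Y, 0, 0) = (0, B Y, 0, 0)"
    by metis
  have "\<alpha> (X, Y, \<xi>, \<eta>) = (A X, B Y, \<mu> * \<xi>, inverse \<mu> * \<eta>)" for X Y \<xi> \<eta>
  proof -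
    have P: "(X, Y, \<xi>, \<eta>) = (X, 0, 0, 0) + (0, Y, 0, 0) + \<xi> *\<^sub>C (0, 0, 1, 0) + \<eta> *\<^sub>C (0, 0, 0, 1)"
      by (simp add: cscale_complex_def)
    show ?thesis
      unfolding P clinear_add[OF l] clinear_cscale[OF l] A B \<mu> N
      by (simp add: N0 \<nu> cscale_complex_def)
  qed
  then show ?thesis
    using u by blast
qed

lemma centralizer_decomp:
  assumes \<alpha>: "\<alpha> \<in> E7" and s: "\<And>P. \<alpha> (sigma7 P) = sigma7 (\<alpha> P)"
    and i: "\<And>P. \<alpha> (iota7 P) = iota7 (\<alpha> P)"
  shows "\<exists>\<theta> t \<delta>. cmod \<theta> = 1 \<and> cmod t = 1 \<and> \<delta> \<in> E6 \<and> \<delta> jE1 = jE1 \<and> \<alpha> = pscale \<theta> \<circ> jlift (phi1 t \<circ> \<delta>)"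
proof -
  obtain \<mu> A B where \<mu>: "cmod \<mu> = 1" and
    f: "\<And>X Y \<xi> \<eta>. \<alpha> (X, Y, \<xi>, \<eta>) = (A X, B Y, \<mu> * \<xi>, inverse \<mu> * \<eta>)"
    using centralizer_form[OF assms] by blast
  \<comment> \<open>A cube root, because \<open>pscale\<close> acts on the third coordinate with
    weight 3.\<close>
  obtain \<theta> where \<theta>: "cmod \<theta> = 1" "\<theta> ^ 3 = \<mu>"
    using unit_root[OF \<mu>, of 3] by auto
  have \<theta>0: "\<theta> \<noteq> 0" "\<mu> \<noteq> 0" using \<theta> \<mu> by auto
  define \<gamma> where "\<gamma> = pscale (inverse \<theta>) \<circ> \<alpha>"
  have u': "tau (inverse \<theta>) * inverse \<theta> = 1"
    using \<theta> unfolding tau_mult_self_eq_1_iff by (simp add: norm_inverse)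
  have \<gamma>: "\<gamma> \<in> E7"
    unfolding \<gamma>_def by (rule E7_comp[OF pscale_E7[OF u'] \<alpha>])
  have "\<gamma> (X, Y, \<xi>, \<eta>) = (\<theta> *\<^sub>C A X, inverse \<theta> *\<^sub>C B Y, \<xi>, \<eta>)" for X Y \<xi> \<eta>
    using \<theta>0 by (simp add: \<gamma>_def pscale_def f power_inverse \<theta>)
  from E7_diagonal[OF \<gamma>, of "\<lambda>X. \<theta> *\<^sub>C A X" "\<lambda>Y. inverse \<theta> *\<^sub>C B Y", OF this]
  obtain C where C: "C \<in> E6" "\<gamma> = jlift C" and CA: "\<And>X. C X = \<theta> *\<^sub>C A X" by blast
  have l: "clinear C" using C E6_clinear by blast
  have \<alpha>': "\<alpha> = pscale \<theta> \<circ> jlift C"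
    using \<theta>0 by (auto simp: fun_eq_iff pscale_1 \<gamma>_def simp flip: C(2) pscale_mult)
  have sA: "A (sigma6 X) = sigma6 (A X)" for X
    using s[of "(X, 0, 0, 0)"] by (simp add: sigma7_def f)
  have sC: "C (sigma6 X) = sigma6 (C X)" for X
    using sA[of X] by (simp add: CA clinear_cscale[OF phi1_clinear] sigma6_phi1)
  have E1: "sigma6 jE1 = jE1" "jcross jE1 jE1 = 0"
    by (simp_all add: sigma6_def jE1_def jcross_coords jordan_eq_0)
  have "\<exists>m. C jE1 = m *\<^sub>C jE1"
  proof (rule rank_one_sigma6)
    show "sigma6 (C jE1) = C jE1"
      by (simp add: E1 flip: sC)
    show "jcross (C jE1) (C jE1) = 0"
      by (simp add: E6_jcross[OF C(1)] E1 clinear_0[OF clinear_cstar[OF l]])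
    \<comment> \<open>Pulled back by \<open>C\<close>, this says that the vectors fixed by
      \<open>sigma6\<close> and annihilated by \<open>jE1\<close> are multiples of
      \<open>jE1\<close>.\<close>
    show "\<exists>k. Z = k *\<^sub>C C jE1" if Z: "sigma6 Z = Z" "jcross (C jE1) Z = 0" for Z
    proof -
      obtain X where X: "Z = C X" by (rule surjE[OF bij_is_surj[OF E6_bij[OF C(1)]]])
      have inj: "C U = C V \<longleftrightarrow> U = V" for U V
        using E6_bij[OF C(1)] by (simp add: bij_is_inj inj_eq)
      have "sigma6 X = X"
        using Z(1) by (simp add: X inj flip: sC)
      then obtain a b c x where X': "X = (a, b, c, x, 0, 0)"
        by (auto simp: sigma6_fixed_iff)
      have tau0: "tau U = 0 \<longleftrightarrow> U = 0" for U :: JC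
        using tau_tau[of U] by auto
      have "C (tau (jcross jE1 X)) = C 0"
        using Z(2) unfolding X E6_jcross[OF C(1)] cstar_def tau0 clinear_0[OF l] .
      then have "jcross jE1 X = 0"
        unfolding inj tau0 .
      then have "X = a *\<^sub>C jE1"
        unfolding X' jcross_jE1 half_cscale_eq_0 by (simp add: jordan_eq_0 jE1_def cscale_complex_def)
      then show ?thesis
        by (auto simp: X clinear_cscale[OF l])
    qed
  qed
  then obtain m where m: "C jE1 = m *\<^sub>C jE1" by blast
  have "jherm jE1 jE1 = 1"
    by (simp add: jE1_def jherm_jE1[unfolded jE1_def])
  then have "cmod m = 1"
    using E6_jherm[OF C(1), of jE1 jE1] unfolding m cmod_eq_1_iff_cnj
    by (simp add: jherm_def jinner_cscale tau_cscale mult.commute)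
  then obtain t where t: "cmod t = 1" "t ^ 4 = m"
    using unit_root[of m 4] by auto
  have t0: "t \<noteq> 0" using t by auto
  define \<delta> where "\<delta> = phi1 (inverse t) \<circ> C"
  have "\<delta> \<in> E6"
    unfolding \<delta>_def using t C(1) by (intro E6_comp phi1_E6) (simp_all add: norm_inverse)
  moreover have "\<delta> jE1 = jE1"
    using t0 by (simp add: \<delta>_def m clinear_cscale[OF phi1_clinear] phi1_jE1 cscale_cscale
      power_inverse flip: t(2))
  moreover have "phi1 t \<circ> \<delta> = C"
    using t0 by (simp add: fun_eq_iff \<delta>_def phi1_1 flip: phi1_mult)
  ultimately show ?thesis
    using \<theta> t \<alpha>' by blast
qed

section \<open>The isomorphism of topological groups\<close>

text \<open>A continuous surjection from a compact space onto a Hausdorff space is a quotient map.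
  Hence so is the bijection induced on cosets, and a bijective quotient map is a
  homeomorphism.\<close>

lemma compact_quotient_top_iso:
  fixes G :: "('a::topological_space) monoid" and H :: "('b::topological_space) monoid"
  assumes "group_hom G H h" and haus: "Hausdorff_space (euclidean :: 'b topology)"
    and onto: "h ` carrier G = carrier H"
    and comp: "compact (carrier G)" and cont: "continuous_on (carrier G) h"
  shows "quotient_top_iso G (kernel G H h) H (\<lambda>X. the_elem (h ` X))"
proof -
  interpret group_hom G H h by fact
  let ?N = "kernel G H h" and ?f = "\<lambda>X. the_elem (h ` X)"
  let ?T = "top_of_set (carrier G)" and ?p = "\<lambda>g. ?N #>\<^bsub>G\<^esub> g"
  let ?Q = "quotient_topology ?T ?p"
  have iso: "?f \<in> iso (G Mod ?N) H"
    by (rule FactGroup_iso_set[OF onto])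
  have fp: "?f (?p g) = h g" if "g \<in> carrier G" for g
  proof -
    have "h ` ?p g = {h g}"
      using that by (auto simp: r_coset_def kernel_def image_iff intro!: bexI[of _ "\<one>\<^bsub>G\<^esub>"])
    then show ?thesis by simp
  qed
  have q: "quotient_map ?T ?Q ?p"
    by (rule quotient_map_quotient_topology)
  have top: "topspace ?Q = carrier (G Mod ?N)"
    using quotient_imp_surjective_map[OF q] by (auto simp: FactGroup_def RCOSETS_def)
  have h: "quotient_map ?T (top_of_set (carrier H)) h"
    by (rule T1_Spaces.continuous_imp_quotient_map)
       (use comp cont onto haus in \<open>auto simp: Hausdorff_space_subtopology
         compact_space_subtopology compactin_euclidean_iff\<close>)
  then have "quotient_map ?T (top_of_set (carrier H)) (?f \<circ> ?p)"
    by (rule quotient_map_eq) (simp add: fp)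
  then have "quotient_map ?Q (top_of_set (carrier H)) ?f"
    using quotient_map_compose_eq[OF q] by blast
  then show ?thesis
    using iso FactGroup_inj_on by (simp add: quotient_top_iso_def homeomorphic_map_def top)
qed

section \<open>Continuity and compactness for pointwise convergence\<close>

lemma bounded_bilinear_jinner: "bounded_bilinear jinner"
  unfolding bilinear_conv_bounded_bilinear[symmetric] bilinear_def
  by (intro conjI allI linearI) (simp_all add: jinner_add scaleR_cscale jinner_cscale
    cscale_complex_def)

lemma bounded_bilinear_jcross: "bounded_bilinear jcross"
  unfolding bilinear_conv_bounded_bilinear[symmetric] bilinear_def
  by (intro conjI allI linearI) (simp_all add: jcross_add scaleR_cscale jcross_cscale)

lemma continuous_on_tau [continuous_intros]:
  fixes f :: "'a::topological_space \<Rightarrow> 'b::{cspace, euclidean_space}"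
  assumes "continuous_on S f"
  shows "continuous_on S (\<lambda>x. tau (f x))"
proof -
  have "linear (tau :: 'b \<Rightarrow> 'b)"
    by (rule linearI) (simp_all add: tau_add scaleR_cscale tau_cscale)
  then show ?thesis
    by (intro bounded_linear.continuous_on[OF _ assms]) (simp add: linear_conv_bounded_linear)
qed

lemma continuous_on_cscale [continuous_intros]:
  fixes f :: "'a::topological_space \<Rightarrow> 'b::{cspace, euclidean_space}"
  assumes c: "continuous_on S c" and f: "continuous_on S f"
  shows "continuous_on S (\<lambda>x. c x *\<^sub>C f x)"
proof -
  have "bilinear (cscale :: complex \<Rightarrow> 'b \<Rightarrow> 'b)"
    unfolding bilinear_def
    by (auto intro!: linearI simp: cscale_add_left cscale_add_right scaleR_cscale cscale_cscale
      cscale_complex_def mult.commute)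
  then show ?thesis
    using bounded_bilinear.continuous_on[OF _ c f] unfolding bilinear_conv_bounded_bilinear by blast
qed

text \<open>Tychonoff: the set is a product of closed balls.\<close>

lemma compact_pointwise_bounded: "compact {f :: 'a \<Rightarrow> 'b::euclidean_space. \<forall>x. norm (f x) \<le> r x}"
proof -
  have "compactin (product_topology (\<lambda>_. euclidean) UNIV) (PiE UNIV (\<lambda>x. cball (0 :: 'b) (r x)))"
    by (simp add: compactin_PiE)
  moreover have "PiE UNIV (\<lambda>x. cball (0 :: 'b) (r x)) = {f. \<forall>x. norm (f x) \<le> r x}"
    by (auto simp: PiE_UNIV_domain)
  ultimately show ?thesis
    by (simp add: euclidean_product_topology)
qed

lemma Hausdorff_space_fun: "Hausdorff_space (euclidean :: ('a \<Rightarrow> 'b::metric_space) topology)"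
  by (simp add: Hausdorff_space_product_topology flip: euclidean_product_topology)

lemma Spin10_carrier: "carrier Spin10 = {\<alpha> \<in> E6. \<alpha> jE1 = jE1}"
  by (simp add: Spin10_def comp_group_def)

text \<open>Each defining equation involves finitely many evaluations and is therefore closed, while
  the preserved hermitian form bounds every value. Bijectivity is not a closed condition, but it
  follows from \<open>bij_of_jherm\<close>.\<close>

lemma compact_Spin10: "compact (carrier Spin10)"
proof -
  let ?B = "{\<alpha>. \<forall>X :: JC. norm (\<alpha> X :: JC) \<le> sqrt (Re (jherm X X))}"
  let ?C = "{\<alpha>. (\<forall>X Y. \<alpha> (X + Y) = \<alpha> X + \<alpha> Y) \<and> (\<forall>c X. \<alpha> (c *\<^sub>C X) = c *\<^sub>C \<alpha> X) \<and>
    (\<forall>X. jdet (\<alpha> X) = jdet X) \<and> (\<forall>X Y. jherm (\<alpha> X) (\<alpha> Y) = jherm X Y) \<and> \<alpha> jE1 = jE1}"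
  note [continuous_intros] = bounded_bilinear.continuous_on[OF bounded_bilinear_jinner]
    bounded_bilinear.continuous_on[OF bounded_bilinear_jcross]
  have ev: "continuous_on UNIV (\<lambda>\<alpha> :: JC \<Rightarrow> JC. \<alpha> X)" for X
    by simp
  have "closed ?C"
    unfolding jdet_def jherm_def
    by (intro closed_Collect_conj closed_Collect_all closed_Collect_eq continuous_intros ev)
  then have "compact (?B \<inter> ?C)"
    by (rule compact_Int_closed[OF compact_pointwise_bounded])
  moreover have "?B \<inter> ?C = carrier Spin10"
  proof (intro equalityI subsetI)
    fix \<alpha> assume "\<alpha> \<in> ?B \<inter> ?C"
    then have a: "clinear \<alpha>" "\<And>X. jdet (\<alpha> X) = jdet X" "\<And>X Y. jherm (\<alpha> X) (\<alpha> Y) = jherm X Y" "\<alpha>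
      jE1 = jE1"
      unfolding clinear_def by blast+
    show "\<alpha> \<in> carrier Spin10"
      unfolding Spin10_carrier using a E6I_jdet[OF a(1) bij_of_jherm[OF a(1) a(3)] a(2,3)] by blast
  next
    fix \<alpha> assume "\<alpha> \<in> carrier Spin10"
    then have a: "\<alpha> \<in> E6" "\<alpha> jE1 = jE1"
      unfolding Spin10_carrier by blast+
    have "norm (\<alpha> X) \<le> sqrt (Re (jherm X X))" for X
      using norm_le_jherm[of "\<alpha> X"] unfolding E6_jherm[OF a(1)] by (rule real_le_rsqrt)
    then show "\<alpha> \<in> ?B \<inter> ?C"
      using a(2) E6_clinear[OF a(1)] E6_jdet[OF a(1)] E6_jherm[OF a(1)] unfolding clinear_def by blast
  qed
  ultimately show ?thesis by simp
qed

section \<open>The groups and the homomorphism \<open>psi\<close>\<close>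

lemma group_comp_group:
  assumes "id \<in> A" and "\<And>f g. f \<in> A \<Longrightarrow> g \<in> A \<Longrightarrow> f \<circ> g \<in> A"
    and "\<And>f. f \<in> A \<Longrightarrow> \<exists>g\<in>A. g \<circ> f = id"
  shows "group (comp_group A)"
  by (rule groupI) (use assms in \<open>auto simp: comp_group_def o_assoc\<close>)

lemma group_Spin10: "group Spin10"
  unfolding Spin10_def
proof (rule group_comp_group)
  show "id \<in> {\<alpha> \<in> E6. \<alpha> jE1 = jE1}"
    using E6_id by simp
  show "f \<circ> g \<in> {\<alpha> \<in> E6. \<alpha> jE1 = jE1}" if "f \<in> {\<alpha> \<in> E6. \<alpha> jE1 = jE1}" "g \<in> {\<alpha> \<in> E6. \<alpha> jE1 = jE1}"
    for f g
    using that E6_comp by simp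
  show "\<exists>g\<in>{\<alpha> \<in> E6. \<alpha> jE1 = jE1}. g \<circ> f = id" if "f \<in> {\<alpha> \<in> E6. \<alpha> jE1 = jE1}" for f
  proof (intro bexI[of _ "inv_into UNIV f"])
    have f: "f \<in> E6" "f jE1 = jE1" using that by blast+
    have i: "inj f" by (rule bij_is_inj[OF E6_bij[OF f(1)]])
    then show "inv_into UNIV f \<circ> f = id"
      by simp
    have "inv_into UNIV f jE1 = jE1"
      using inv_into_f_f[OF i UNIV_I, of jE1] by (simp only: f(2))
    then show "inv_into UNIV f \<in> {\<alpha> \<in> E6. \<alpha> jE1 = jE1}"
      using E6_inv[OF f(1)] by blast
  qed
qed

lemma U1_carrier: "carrier U1 = sphere 0 1"
  by (auto simp: U1_def tau_mult_self_eq_1_iff)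

lemma group_U1: "group U1"
proof (rule groupI)
  show "\<exists>y\<in>carrier U1. y \<otimes>\<^bsub>U1\<^esub> x = \<one>\<^bsub>U1\<^esub>" if "x \<in> carrier U1" for x
    using that by (intro bexI[of _ "inverse x"]) (auto simp: U1_carrier norm_inverse, auto simp:
      U1_def tau_mult_self_eq_1_iff intro!: left_inverse)
qed (auto simp: U1_carrier norm_mult, auto simp: U1_def norm_mult)

abbreviation UUS where "UUS \<equiv> U1 \<times>\<times> U1 \<times>\<times> Spin10"

lemma group_UUS: "group UUS"
  by (intro DirProd_group group_U1 group_Spin10)

lemma UUS_iff: "(\<theta>, t, \<delta>) \<in> carrier UUS \<longleftrightarrow> cmod \<theta> = 1 \<and> cmod t = 1 \<and> \<delta> \<in> E6 \<and> \<delta> jE1 = jE1"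
  by (simp add: U1_carrier Spin10_carrier)

lemma UUS_mult: "(\<theta>, t, \<delta>) \<otimes>\<^bsub>UUS\<^esub> (\<theta>', t', \<delta>') = (\<theta> * \<theta>', t * t', \<delta> \<circ> \<delta>')"
  by (simp add: U1_def Spin10_def comp_group_def)

lemma UUS_one: "\<one>\<^bsub>UUS\<^esub> = (1, 1, id)"
  by (simp add: U1_def Spin10_def comp_group_def)

definition psi :: "complex \<times> complex \<times> (JC \<Rightarrow> JC) \<Rightarrow> PC \<Rightarrow> PC" where
  "psi = (\<lambda>(\<theta>, t, \<delta>). pscale \<theta> \<circ> jlift (phi1 t \<circ> \<delta>))"

lemma jlift_comp: "jlift (\<alpha> \<circ> \<beta>) P = jlift \<alpha> (jlift \<beta> P)"
  by (cases P rule: PC_cases) (simp add: jlift_def cstar_def tau_tau)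

lemma jlift_pscale: "clinear \<alpha> \<Longrightarrow> jlift \<alpha> (pscale \<theta> P) = pscale \<theta> (jlift \<alpha> P)"
  by (cases P rule: PC_cases)
    (simp add: jlift_def pscale_def clinear_cscale clinear_cscale[OF clinear_cstar])

text \<open>\<open>phi1 t'\<close> passes \<delta> by \<open>E6_fix_E1_commute\<close>, and
  \<open>pscale\<close> commutes with lifts of linear maps.\<close>

lemma psi_mult:
  assumes "g \<in> carrier UUS" "h \<in> carrier UUS"
  shows "psi (g \<otimes>\<^bsub>UUS\<^esub> h) = psi g \<circ> psi h"
proof -
  obtain \<theta> t \<delta> where g: "g = (\<theta>, t, \<delta>)" by (rule prod_cases3)
  obtain \<theta>' t' \<delta>' where h: "h = (\<theta>', t', \<delta>')" by (rule prod_cases3)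
  have d: "\<delta> \<in> E6" "\<delta> jE1 = jE1"
    using assms(1) unfolding g UUS_iff by blast+
  have e: "phi1 (t * t') \<circ> (\<delta> \<circ> \<delta>') = (phi1 t \<circ> \<delta>) \<circ> (phi1 t' \<circ> \<delta>')"
    by (rule ext) (simp add: phi1_mult E6_fix_E1_commute[OF d])
  show ?thesis
    unfolding g h UUS_mult psi_def prod.case e
    by (simp add: fun_eq_iff pscale_mult jlift_comp
      jlift_pscale[OF clinear_comp[OF phi1_clinear E6_clinear[OF d(1)]], unfolded jlift_comp])
qed

lemma psi_one: "psi (1, 1, id) = id"
proof
  show "psi (1, 1, id) P = id P" for P
    by (cases P rule: PC_cases) (simp add: psi_def pscale_1 jlift_def phi1_1 cstar_def tau_tau)
qed

lemma psi_image: "psi ` carrier UUS = E7_fixed neg_sigma7 \<inter> E7_fixed iota7"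
proof (intro equalityI subsetI)
  fix \<alpha> assume "\<alpha> \<in> psi ` carrier UUS"
  then obtain g where g': "g \<in> carrier UUS" "\<alpha> = psi g" by blast
  obtain \<theta> t \<delta> where "g = (\<theta>, t, \<delta>)" by (rule prod_cases3)
  with g' have \<theta>: "cmod \<theta> = 1" and t: "cmod t = 1" and \<delta>: "\<delta> \<in> E6" "\<delta> jE1 = jE1"
    and \<alpha>: "\<alpha> = pscale \<theta> \<circ> jlift (phi1 t \<circ> \<delta>)"
    unfolding psi_def by (auto simp: U1_carrier Spin10_carrier)
  let ?\<beta> = "phi1 t \<circ> \<delta>"
  have \<beta>: "?\<beta> \<in> E6"
    by (rule E6_comp[OF phi1_E6[OF t] \<delta>(1)])
  note l = E6_clinear[OF \<beta>]
  note l' = clinear_cstar[OF l]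
  \<comment> \<open>\<open>sigma6\<close> is \<open>phi1 (- 1)\<close>, so it commutes with both
    factors.\<close>
  have s: "?\<beta> (sigma6 X) = sigma6 (?\<beta> X)" for X
    using E6_fix_E1_commute[OF \<delta>] by (simp add: sigma6_phi1 flip: phi1_mult)
  have ts: "tau (sigma6 X) = sigma6 (tau X)" for X
    by (cases X rule: jordan_cases) (simp add: sigma6_def tau_minus)
  have s': "cstar ?\<beta> (sigma6 X) = sigma6 (cstar ?\<beta> X)" for X
    unfolding cstar_def ts s ..
  have "\<alpha> \<in> E7"
    unfolding \<alpha> using \<theta> by (intro E7_comp pscale_E7 jlift_E7 \<beta>) (simp add: tau_mult_self_eq_1_iff)
  moreover have "\<alpha> (sigma7 P) = sigma7 (\<alpha> P)" for P
    unfolding \<alpha>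
    by (cases P rule: PC_cases) (simp add: sigma7_def pscale_def jlift_def s[unfolded o_apply] s'
      clinear_cscale[OF phi1_clinear] sigma6_phi1 s'[unfolded sigma6_phi1] s[unfolded sigma6_phi1
        o_apply])
  moreover have "\<alpha> (iota7 P) = iota7 (\<alpha> P)" for P
    unfolding \<alpha> o_apply[of "pscale \<theta>"]
    by (cases P rule: PC_cases) (simp add: iota7_def pscale_def jlift_def clinear_cscale[OF l']
      clinear_cscale[OF l, unfolded o_apply]
      linear_neg[OF clinear_linear[OF l'] ] linear_neg[OF clinear_linear[OF l], unfolded o_apply]
      cscale_cscale mult.commute mult.left_commute)
  ultimately show "\<alpha> \<in> E7_fixed neg_sigma7 \<inter> E7_fixed iota7"
    unfolding centralizer_iff by blast
next
  fix \<alpha> assume "\<alpha> \<in> E7_fixed neg_sigma7 \<inter> E7_fixed iota7"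
  then obtain \<theta> t \<delta> where "cmod \<theta> = 1" "cmod t = 1" "\<delta> \<in> E6" "\<delta> jE1 = jE1"
    and \<alpha>: "\<alpha> = pscale \<theta> \<circ> jlift (phi1 t \<circ> \<delta>)"
    unfolding centralizer_iff using centralizer_decomp by blast
  then have "(\<theta>, t, \<delta>) \<in> carrier UUS"
    unfolding UUS_iff by blast
  moreover have "\<alpha> = psi (\<theta>, t, \<delta>)"
    by (simp add: \<alpha> psi_def)
  ultimately show "\<alpha> \<in> psi ` carrier UUS"
    by blast
qed

text \<open>The image inherits closure and inverses from \<open>G\<close>; through
  \<open>psi_image\<close> this also yields the group structure of the centralizer.\<close>

lemma group_hom_comp_group:
  assumes "group G" and one: "h \<one>\<^bsub>G\<^esub> = id"
    and mult: "\<And>x y. x \<in> carrier G \<Longrightarrow> y \<in> carrier G \<Longrightarrow> h (x \<otimes>\<^bsub>G\<^esub> y) = h x \<circ> h y"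
  shows "group_hom G (comp_group (h ` carrier G)) h"
proof -
  interpret group G by fact
  have 1: "id \<in> h ` carrier G"
    using imageI[OF one_closed, of h] by (simp only: one)
  have 2: "f \<circ> g \<in> h ` carrier G" if fg: "f \<in> h ` carrier G" "g \<in> h ` carrier G" for f g
  proof -
    obtain a where a: "f = h a" "a \<in> carrier G" by (rule imageE[OF fg(1)])
    obtain b where b: "g = h b" "b \<in> carrier G" by (rule imageE[OF fg(2)])
    show ?thesis
      unfolding a(1) b(1) mult[OF a(2) b(2), symmetric] by (intro imageI m_closed a b)
  qed
  have 3: "\<exists>g\<in>h ` carrier G. g \<circ> f = id" if f: "f \<in> h ` carrier G" for f
  proof -
    obtain a where a: "f = h a" "a \<in> carrier G" by (rule imageE[OF f])
    have "h (inv\<^bsub>G\<^esub> a) \<circ> f = id"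
      by (simp only: a(1) mult[OF inv_closed[OF a(2)] a(2), symmetric] l_inv[OF a(2)] one)
    then show ?thesis
      using inv_closed[OF a(2)] by blast
  qed
  have "group (comp_group (h ` carrier G))"
    by (rule group_comp_group[OF 1 2 3])
  then show ?thesis
    using \<open>group G\<close> by (simp add: group_hom_def group_hom_axioms_def hom_def comp_group_def mult)
qed

lemma group_hom_psi: "group_hom UUS (comp_group (E7_fixed neg_sigma7 \<inter> E7_fixed iota7)) psi"
  unfolding psi_image[symmetric]
  by (rule group_hom_comp_group[OF group_UUS]) (simp_all only: psi_mult UUS_one psi_one)

lemma continuous_psi: "continuous_on (carrier UUS) psi"
proof (rule continuous_on_coordinatewise_then_product)
  fix P :: PC
  obtain X Y \<xi> \<eta> where P: "P = (X, Y, \<xi>, \<eta>)" by (rule PC_cases)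
  let ?S = "carrier UUS"
  have c: "continuous_on ?S fst" "continuous_on ?S (\<lambda>g. fst (snd g))"
    by (intro continuous_intros)+
  have d: "continuous_on ?S (\<lambda>g. snd (snd g) X)" for X
    by (rule continuous_on_product_then_coordinatewise) (intro continuous_intros)
  have n: "fst g \<noteq> 0" "fst (snd g) \<noteq> 0" if "g \<in> ?S" for g
    using that by (auto simp: U1_carrier)
  have p: "continuous_on ?S (\<lambda>g. phi1 (fst (snd g)) (snd (snd g) X))" for X
    unfolding phi1_def case_prod_unfold
    by (intro continuous_intros c d) (use n in auto)
  have "continuous_on ?S (\<lambda>g. (inverse (fst g) *\<^sub>C phi1 (fst (snd g)) (snd (snd g) X),
      fst g *\<^sub>C tau (phi1 (fst (snd g)) (snd (snd g) (tau Y))), fst g ^ 3 * \<xi>, inverse (fst g) ^ 3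
        * \<eta>))"
    by (intro continuous_intros c p) (use n in auto)
  then show "continuous_on ?S (\<lambda>g. psi g P)"
    by (simp add: psi_def case_prod_unfold pscale_def jlift_def cstar_def P)
qed

lemma compact_UUS: "compact (carrier UUS)"
  unfolding carrier_DirProd U1_carrier by (intro compact_Times compact_sphere compact_Spin10)

section \<open>The kernel of \<open>psi\<close>\<close>

lemma cube_roots:
  fixes \<omega> \<theta> :: complex
  assumes "\<omega> ^ 3 = 1" "\<omega> \<noteq> 1" "\<theta> ^ 3 = 1"
  shows "\<theta> \<in> {1, \<omega>, \<omega>\<^sup>2}"
proof -
  have "(\<omega> - 1) * (1 + \<omega> + \<omega>\<^sup>2) = 0"
    using assms(1) by (simp add: algebra_simps power2_eq_square power3_eq_cube)
  then have s: "1 + \<omega> + \<omega>\<^sup>2 = 0"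
    using assms(2) by simp
  have "(\<theta> - 1) * (\<theta> - \<omega>) * (\<theta> - \<omega>\<^sup>2) = \<theta> ^ 3 - (1 + \<omega> + \<omega>\<^sup>2) * \<theta>\<^sup>2 + (\<omega> + \<omega>\<^sup>2 + \<omega> ^ 3) * \<theta> - \<omega> ^ 3"
    by (simp add: algebra_simps power2_eq_square power3_eq_cube)
  also have "\<omega> + \<omega>\<^sup>2 + \<omega> ^ 3 = 0"
    using s assms(1) by (simp add: algebra_simps)
  finally show ?thesis
    using s assms by auto
qed

lemma fourth_roots:
  fixes u :: complex
  assumes "u ^ 4 = 1"
  shows "u \<in> {1, - 1, \<i>, - \<i>}"
proof -
  have "(u - 1) * (u + 1) * (u - \<i>) * (u + \<i>) = u ^ 4 - 1"
    by (simp add: algebra_simps power4_eq_xxxx)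
  then show ?thesis
    using assms by (auto simp: eq_neg_iff_add_eq_0)
qed

text \<open>The two factors \<open>phi1\<close> combine to the scalar \<theta>, which
  \<open>pscale \<theta>\<close> cancels on the first copy of the Jordan algebra and, conjugated, on
  the second.\<close>

lemma psi_phi1:
  assumes "\<theta> ^ 3 = 1" "t \<noteq> 0" "t * s = \<theta>" "cmod t = 1"  "cmod s = 1"
  shows "psi (\<theta>, t, phi1 s) = id"
proof
  have \<theta>: "cmod \<theta> = 1" "\<theta> \<noteq> 0"
    using assms(3)[symmetric] assms(2,4,5) by (auto simp: norm_mult)
  have e: "phi1 t \<circ> phi1 s = (*\<^sub>C) \<theta>"
    using assms(1,3) by (auto simp: fun_eq_iff phi1_cube_root simp flip: phi1_mult)
  show "psi (\<theta>, t, phi1 s) P = id P" for P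
    using \<theta> assms(1) unfolding psi_def prod.case e
    by (cases P rule: PC_cases)
      (simp add: pscale_def jlift_def cstar_def tau_cscale tau_tau cnj_unit cscale_cscale power_inverse)
qed

lemma kernel_psi:
  assumes \<omega>: "\<omega> ^ 3 = 1" "\<omega> \<noteq> 1"
  shows "kernel UUS (comp_group A) psi = Z4 <#>\<^bsub>UUS\<^esub> Z3 \<omega>"
proof -
  have i: "phi1 (- \<i>) = sigma6 \<circ> phi1 \<i>"
    by (auto simp: fun_eq_iff sigma6_phi1 simp flip: phi1_mult)
  \<comment> \<open>A uniform parametrization by fourth roots of unity, in which
    \<open>sigma6\<close> is \<open>phi1 (- 1)\<close> and the inverse of -\<i> is \<i>.\<close>
  have Z4: "Z4 = {(1, u, phi1 (inverse u)) |u. u ^ 4 = 1}"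
  proof -
    have "{(1, u, phi1 (inverse u)) |u. u ^ 4 = 1} = (\<lambda>u. (1, u, phi1 (inverse u))) ` {u. u ^ 4 = 1}"
      by blast
    also have "{u :: complex. u ^ 4 = 1} = {1, - 1, \<i>, - \<i>}"
      using fourth_roots by auto
    finally show ?thesis
      by (simp add: Z4_def phi1_1 sigma6_phi1[symmetric] i) (rule sym)
  qed
  have Z3: "Z3 \<omega> = {(\<theta>, \<theta>, id) |\<theta>. \<theta> ^ 3 = 1}"
    using cube_roots[OF \<omega>] \<omega>(1) power_mult[of \<omega> 3 2] by (auto simp: Z3_def simp flip: power_mult)
  have u3: "cmod \<theta> = 1" if "\<theta> ^ n = 1" "0 < n" for \<theta> :: complex and n
    using that by (metis norm_one norm_power norm_ge_zero power_eq_1_iff neq0_conv abs_norm_cancel)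
  show ?thesis
  proof (intro equalityI subsetI)
    fix g assume g: "g \<in> kernel UUS (comp_group A) psi"
    obtain \<theta> t \<delta> where g': "g = (\<theta>, t, \<delta>)" by (rule prod_cases3)
    have c: "cmod \<theta> = 1" "cmod t = 1" "\<delta> jE1 = jE1" and k: "psi (\<theta>, t, \<delta>) = id"
      using g unfolding g' kernel_def by (simp_all add: U1_carrier Spin10_carrier comp_group_def)
    have n: "\<theta> \<noteq> 0" "t \<noteq> 0" using c by auto
    have \<theta>3: "\<theta> ^ 3 = 1"
      using fun_cong[OF k, of "(0, 0, 1, 0)"] by (simp add: psi_def pscale_def jlift_def)
    have X: "inverse \<theta> *\<^sub>C phi1 t (\<delta> X) = X" for X
      using fun_cong[OF k, of "(X, 0, 0, 0)"] by (simp add: psi_def pscale_def jlift_def)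
    have t4: "t ^ 4 = \<theta>"
      using X[of jE1] n by (simp add: c phi1_jE1 cscale_cscale) (simp add: jE1_def
        cscale_complex_def field_simps)
    \<comment> \<open>The \<open>Z4\<close> component: \<open>t ^ 4 = \<theta>\<close> and
      \<open>\<theta> ^ 4 = \<theta>\<close> make it a fourth root of unity, and (\<theta>,
      \<theta>, \<open>id\<close>) is the remaining \<open>Z3\<close> factor.\<close>
    define u where "u = t * inverse \<theta>"
    have u4: "u ^ 4 = 1"
      using t4 \<theta>3 n by (simp add: u_def power_mult_distrib power_inverse field_simps
        power4_eq_xxxx power3_eq_cube)
    have "\<delta> X = phi1 (inverse u) X" for X
    proof -
      have "phi1 (inverse t) (phi1 t (\<delta> X)) = phi1 (inverse t) (\<theta> *\<^sub>C X)"
        using n by (subst X[of X, symmetric]) (simp add: cscale_cscale)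
      then have "\<delta> X = phi1 (inverse t) (phi1 \<theta> X)"
        using n by (simp add: phi1_1 phi1_cube_root[OF \<theta>3] flip: phi1_mult)
      then show ?thesis
        using n by (simp add: u_def mult.commute flip: phi1_mult)
    qed
    then have "\<delta> = phi1 (inverse u)" by blast
    then have "g = (1, u, phi1 (inverse u)) \<otimes>\<^bsub>UUS\<^esub> (\<theta>, \<theta>, id)"
      unfolding g' UUS_mult using n by (simp add: u_def)
    then show "g \<in> Z4 <#>\<^bsub>UUS\<^esub> Z3 \<omega>"
      unfolding set_mult_def Z4 Z3 using u4 \<theta>3 by blast
  next
    fix g assume "g \<in> Z4 <#>\<^bsub>UUS\<^esub> Z3 \<omega>"
    then obtain u \<theta> where u: "u ^ 4 = 1" and \<theta>: "\<theta> ^ 3 = 1"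
      and "g = (1, u, phi1 (inverse u)) \<otimes>\<^bsub>UUS\<^esub> (\<theta>, \<theta>, id)"
      unfolding set_mult_def Z4 Z3 by blast
    then have g: "g = (\<theta>, u * \<theta>, phi1 (inverse u))"
      unfolding UUS_mult by simp
    have c: "cmod u = 1" "cmod \<theta> = 1"
      using u \<theta> u3[of _ 4] u3[of _ 3] by auto
    then have n: "u \<noteq> 0" "\<theta> \<noteq> 0" by auto
    have "psi g = id"
      unfolding g using n c \<theta> by (intro psi_phi1) (auto simp: norm_mult norm_inverse)
    moreover have "phi1 (inverse u) jE1 = jE1"
      using u by (simp add: phi1_jE1 power_inverse)
    ultimately show "g \<in> kernel UUS (comp_group A) psi"
      using c phi1_E6[of "inverse u"] unfolding kernel_def g
      by (simp add: U1_carrier Spin10_carrier comp_group_def norm_mult norm_inverse)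
  qed
qed

theorem theorem4p18p4:
  fixes \<omega> :: complex
  assumes "\<omega> ^ 3 = 1" and "\<omega> \<noteq> 1"
  shows "(Z4 <#>\<^bsub>U1 \<times>\<times> U1 \<times>\<times> Spin10\<^esub> Z3 \<omega>) \<lhd> (U1 \<times>\<times> U1 \<times>\<times> Spin10) \<and>
    (\<exists>f. quotient_top_iso (U1 \<times>\<times> U1 \<times>\<times> Spin10) (Z4 <#>\<^bsub>U1 \<times>\<times> U1 \<times>\<times> Spin10\<^esub> Z3 \<omega>)
           (comp_group (E7_fixed neg_sigma7 \<inter> E7_fixed iota7)) f)"
proof -
  let ?H = "comp_group (E7_fixed neg_sigma7 \<inter> E7_fixed iota7)"
  interpret group_hom UUS ?H psi
    by (rule group_hom_psi)
  have "psi ` carrier UUS = carrier ?H"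
    by (simp add: psi_image comp_group_def del: carrier_DirProd)
  from compact_quotient_top_iso[OF group_hom_psi Hausdorff_space_fun this compact_UUS
    continuous_psi] normal_kernel
  show ?thesis
    unfolding kernel_psi[OF assms] by blast
qed

end
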